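(* Let $K\ge 2$ and suppose that the prior densities $\pi$ and $\varrho$ on $\Delta$ both satisfy Condition $\mathcal P$ (possibly with different exponent vectors). Let $\bar k\in\{1,\dots,K\}$, $c\in(0,\infty)$, and $\epsilon,\delta,\eta\in(0,1)$. Then there exists $N\in\mathbb N$ such that for every deterministic sequence of choices of the dice (blue or red) to be tossed, \[ \mathbb P_\vartheta\bigl(\hat p_{\bar k}(X^n)\ge c(1-\delta)\,\hat q_{\bar k}(X^n)\bigr)\ge 1-\epsilon \] for all $\vartheta=(p,q)\in\Delta^2$ with $p_{\bar k}\ge c\,q_{\bar k}$ and all $n\in\mathbb N$ with $b_n p_{\bar k}\ge N$ and $b_n/n\le 1-\eta$. (In particular $N$ depends neither on $\vartheta$, nor on $n$, nor on the sequence of choices.)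
   Context: $\mathbb N$ is the set of positive integers. $\Delta=\{p\in[0,1]^K: p_1+\dots+p_K=1\}$, $\operatorname{int}\Delta$ is its (relative) interior, i.e. the points with all coordinates positive, and $\lambda$ is the Lebesgue measure on $\Delta$ normalized by $\lambda(\Delta)=1/(K-1)!$. A density on $\Delta$ means a probability density with respect to $\lambda$. Condition $\mathcal P$: a density $\pi$ on $\Delta$ satisfies Condition $\mathcal P(\alpha)$, where $\alpha=(\alpha_1,\dots,\alpha_K)\in(0,\infty)^K$, if $\pi(p)/\prod_{k=1}^K p_k^{\alpha_k-1}$ is uniformly continuous and bounded away from zero on $\operatorname{int}\Delta$; $\pi$ satisfies Condition $\mathcal P$ if it satisfies $\mathcal P(\alpha)$ for some $\alpha\in(0,\infty)^K$. Setting: there are two $K$-sided dice, blue and red. In each period $1,2,\dots$ one die is chosen, here according to a deterministic sequence fixed in advance, and tossed. The blue die lands on side $k$ with probability $p_k$, the red die with probability $q_k$, independently of past outcomes; the parameter is $\vartheta=(p,q)\in\Delta^2$ and $\mathbb P_\vartheta$ is the probability under $\vartheta$. $X^n$ denotes the colors and sides of the first $n$ tosses and $b_n$ the number of times the blue die is tossed in the first $n$ periods. The observer's prior on $\Delta^2$ has the product density $\pi(p)\varrho(q)$. The Bayes estimators are the posterior means: if $y_i$ (resp. $z_i$) is the number of times the blue (resp. red) die lands on side $i$ in the first $n$ periods, then \[ \hat p_k(X^n)=\frac{\int p_k\prod_{i=1}^K p_i^{y_i}\,\pi(p)\,d\lambda(p)}{\int \prod_{i=1}^K p_i^{y_i}\,\pi(p)\,d\lambda(p)},\qquad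 \hat q_k(X^n)=\frac{\int q_k\prod_{i=1}^K q_i^{z_i}\,\varrho(q)\,d\lambda(q)}{\int \prod_{i=1}^K q_i^{z_i}\,\varrho(q)\,d\lambda(q)}. \] *)

theory Defs
  imports "HOL-Probability.Probability"
begin

section \<open>The simplex and its Lebesgue measure\<close>

text \<open>The number of sides is \<open>K = CARD('k)\<close>; the sides are the elements of \<open>'k\<close>.\<close>

definition prob_simplex :: "(real ^ 'k::finite) set" where
  "prob_simplex = {p. (\<forall>k. 0 \<le> p $ k \<and> p $ k \<le> 1) \<and> (\<Sum>k\<in>UNIV. p $ k) = 1}"

definition int_simplex :: "(real ^ 'k::finite) set" where
  "int_simplex = {p \<in> prob_simplex. \<forall>k. 0 < p $ k}"

text \<open>The affine chart of the hyperplane \<open>p\<^sub>1 + \<dots> + p\<^sub>K = 1\<close> that omits coordinate \<open>j\<close>. Pushing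
  forward the \<open>(K-1)\<close>-dimensional Lebesgue measure along it gives the simplex mass
  \<open>1 / (K-1)!\<close>, whatever \<open>j\<close> is; see \<open>simplex_lebesgue_via_indep\<close> and
  \<open>emeasure_simplex_lebesgue\<close> below.\<close>

definition simplex_chart :: "'k \<Rightarrow> ('k \<Rightarrow> real) \<Rightarrow> real ^ 'k::finite" where
  "simplex_chart j x = (\<chi> k. if k = j then 1 - (\<Sum>i\<in>UNIV - {j}. x i) else x k)"

definition simplex_lebesgue_via :: "'k \<Rightarrow> (real ^ 'k::finite) measure" where
  "simplex_lebesgue_via j =
     completion (restrict_space
       (distr (Pi\<^sub>M (UNIV - {j}) (\<lambda>_. lborel)) borel (simplex_chart j)) prob_simplex)"

definition simplex_lebesgue :: "(real ^ 'k::finite) measure" where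
  "simplex_lebesgue = simplex_lebesgue_via (SOME j. True)"

lemma prob_simplex_closed: "closed (prob_simplex :: (real ^ 'k::finite) set)"
  unfolding prob_simplex_def
  by (intro closed_Collect_conj closed_Collect_all closed_Collect_le closed_Collect_eq
        continuous_intros)

lemma prob_simplex_sets [measurable]: "(prob_simplex :: (real ^ 'k::finite) set) \<in> sets borel"
  using prob_simplex_closed by (rule borel_closed)

lemma int_simplex_eq_rel_interior:
  "(int_simplex :: (real ^ 'k::finite) set) = rel_interior prob_simplex"
proof -
  let ?B = "range (\<lambda>k. axis k 1 :: real ^ 'k)"
  have inj: "inj (\<lambda>k. axis k (1::real) :: real ^ 'k)"
    by (auto simp: inj_on_def axis_eq_axis)
  have ax: "(\<Sum>x\<in>?B. u x *\<^sub>R x) = (\<chi> k. u (axis k 1))" for u :: "real ^ 'k \<Rightarrow> real"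
    by (subst sum.reindex[OF inj]) (auto simp: vec_eq_iff axis_def if_distrib cong: if_cong)
  have su: "sum u ?B = (\<Sum>k\<in>UNIV. u (axis k 1))" for u :: "real ^ 'k \<Rightarrow> real"
    by (subst sum.reindex[OF inj]) auto
  have basis: "?B = Basis"
    by (auto simp: Basis_vec_def)
  have "\<not> affine_dependent ?B"
    unfolding basis using affine_dependent_imp_dependent independent_Basis by blast
  note ri = rel_interior_convex_hull_explicit[OF this]
  have ex: "\<exists>u :: real ^ 'k \<Rightarrow> real. \<forall>k. u (axis k 1) = p $ k" for p :: "real ^ 'k"
    by (intro exI[of _ "\<lambda>x. p $ inv (\<lambda>k. axis k 1) x"]) (simp add: inv_f_f[OF inj])
  have le1: "p $ k \<le> 1" if "\<forall>k. 0 \<le> p $ k" "(\<Sum>k\<in>UNIV. p $ k) = 1" for p :: "real ^ 'k" and k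
    using member_le_sum[of k UNIV "\<lambda>k. p $ k"] that by auto
  have hull: "convex hull ?B = prob_simplex"
  proof -
    have "convex hull ?B = {y. \<exists>u. (\<forall>x\<in>?B. 0 \<le> u x) \<and> sum u ?B = 1 \<and> (\<Sum>x\<in>?B. u x *\<^sub>R x) = y}"
      by (rule convex_hull_finite) auto
    also have "\<dots> = prob_simplex"
    proof (intro set_eqI iffI)
      fix y :: "real ^ 'k"
      assume "y \<in> {y. \<exists>u. (\<forall>x\<in>?B. 0 \<le> u x) \<and> sum u ?B = 1 \<and> (\<Sum>x\<in>?B. u x *\<^sub>R x) = y}"
      then have "(\<forall>k. 0 \<le> y $ k) \<and> (\<Sum>k\<in>UNIV. y $ k) = 1"
        by (auto simp: ax su)
      then show "y \<in> prob_simplex"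
        using le1[of y] by (simp add: prob_simplex_def)
    next
      fix y :: "real ^ 'k" assume y: "y \<in> prob_simplex"
      obtain u :: "real ^ 'k \<Rightarrow> real" where "\<forall>k. u (axis k 1) = y $ k" using ex by blast
      then show "y \<in> {y. \<exists>u. (\<forall>x\<in>?B. 0 \<le> u x) \<and> sum u ?B = 1 \<and> (\<Sum>x\<in>?B. u x *\<^sub>R x) = y}"
        using y by (auto simp: ax su prob_simplex_def intro!: exI[of _ u])
    qed
    finally show ?thesis .
  qed
  have "rel_interior (prob_simplex :: (real ^ 'k) set) =
      {y. \<exists>u. (\<forall>x\<in>?B. 0 < u x) \<and> sum u ?B = 1 \<and> (\<Sum>x\<in>?B. u x *\<^sub>R x) = y}"
    using ri unfolding hull .
  also have "\<dots> = int_simplex"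
  proof (intro set_eqI iffI)
    fix y :: "real ^ 'k"
    assume "y \<in> {y. \<exists>u. (\<forall>x\<in>?B. 0 < u x) \<and> sum u ?B = 1 \<and> (\<Sum>x\<in>?B. u x *\<^sub>R x) = y}"
    then have "(\<forall>k. 0 < y $ k) \<and> (\<Sum>k\<in>UNIV. y $ k) = 1"
      by (auto simp: ax su)
    then show "y \<in> int_simplex"
      using le1[of y] by (simp add: prob_simplex_def int_simplex_def less_imp_le)
  next
    fix y :: "real ^ 'k" assume y: "y \<in> int_simplex"
    obtain u :: "real ^ 'k \<Rightarrow> real" where "\<forall>k. u (axis k 1) = y $ k" using ex by blast
    then show "y \<in> {y. \<exists>u. (\<forall>x\<in>?B. 0 < u x) \<and> sum u ?B = 1 \<and> (\<Sum>x\<in>?B. u x *\<^sub>R x) = y}"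
      using y by (auto simp: ax su prob_simplex_def int_simplex_def intro!: exI[of _ u])
  qed
  finally show ?thesis ..
qed

lemma simplex_chart_measurable [measurable]:
  "(simplex_chart j :: _ \<Rightarrow> real ^ 'k::finite) \<in> borel_measurable (Pi\<^sub>M (UNIV - {j}) (\<lambda>_. lborel))"
proof -
  have "(\<lambda>x. simplex_chart j x $ k) \<in> borel_measurable (Pi\<^sub>M (UNIV - {j}) (\<lambda>_. lborel))" for k
    by (cases "k = j") (auto simp: simplex_chart_def)
  then show ?thesis
    by (subst borel_measurable_euclidean_space)
       (auto simp: Basis_vec_def inner_axis)
qed

lemma simplex_lebesgue_via_indep:
  "(simplex_lebesgue_via j :: (real ^ 'k::finite) measure) = simplex_lebesgue_via j'"
proof (cases "j = j'")
  case False
  interpret product_sigma_finite "\<lambda>_::'k. lborel :: real measure" by standard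
  define I where "I = UNIV - {j, j'}"
  have I: "UNIV - {j} = insert j' I" "UNIV - {j'} = insert j I" "j \<notin> I" "j' \<notin> I" "finite I"
    using False by (auto simp: I_def)
  have chart: "simplex_chart j (x(j' := 1 - sum x I - y)) = simplex_chart j' (x(j := y))" for x y
    using False I
    unfolding simplex_chart_def vec_eq_iff I(1,2)
    by (auto simp: fun_upd_def if_distrib intro!: sum.cong)
  have "distr (Pi\<^sub>M (UNIV - {j}) (\<lambda>_. lborel)) borel (simplex_chart j) =
        distr (Pi\<^sub>M (UNIV - {j'}) (\<lambda>_. lborel)) borel (simplex_chart j')"
  proof (rule measure_eqI)
    fix A :: "(real ^ 'k) set"
    assume "A \<in> sets (distr (Pi\<^sub>M (UNIV - {j}) (\<lambda>_. lborel)) borel (simplex_chart j))"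
    then have [measurable]: "A \<in> sets borel" by simp
    have em: "emeasure (distr (Pi\<^sub>M (UNIV - {i}) (\<lambda>_. lborel)) borel (simplex_chart i)) A =
        (\<integral>\<^sup>+x. indicator A (simplex_chart i x) \<partial>Pi\<^sub>M (UNIV - {i}) (\<lambda>_. lborel))" for i
      using nn_integral_distr[of "simplex_chart i" "Pi\<^sub>M (UNIV - {i}) (\<lambda>_. lborel)" borel "indicator A"]
      by simp
    have meas: "(\<lambda>x. indicator A (simplex_chart i x) :: ennreal)
        \<in> borel_measurable (Pi\<^sub>M (UNIV - {i}) (\<lambda>_. lborel))" for i
      by measurable
    have "emeasure (distr (Pi\<^sub>M (UNIV - {j}) (\<lambda>_. lborel)) borel (simplex_chart j)) A =
        (\<integral>\<^sup>+x. \<integral>\<^sup>+y. indicator A (simplex_chart j (x(j' := y))) \<partial>lborel \<partial>Pi\<^sub>M I (\<lambda>_. lborel))"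
      unfolding em using meas[of j] I by (simp add: product_nn_integral_insert)
    also have "\<dots> = (\<integral>\<^sup>+x. \<integral>\<^sup>+y. indicator A (simplex_chart j' (x(j := y))) \<partial>lborel \<partial>Pi\<^sub>M I (\<lambda>_. lborel))"
    proof (rule nn_integral_cong)
      fix x assume x: "x \<in> space (Pi\<^sub>M I (\<lambda>_. lborel :: real measure))"
      have "(\<lambda>y. x(j' := y)) \<in> lborel \<rightarrow>\<^sub>M Pi\<^sub>M (insert j' I) (\<lambda>_. lborel)"
        using x by (intro measurable_fun_upd[where J = I]) auto
      then have m: "(\<lambda>y. indicator A (simplex_chart j (x(j' := y))) :: ennreal) \<in> borel_measurable borel"
        using measurable_compose[OF _ meas[of j]] I(1) by (metis measurable_lborel2)
      show "(\<integral>\<^sup>+y. indicator A (simplex_chart j (x(j' := y))) \<partial>lborel) =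
            (\<integral>\<^sup>+y. indicator A (simplex_chart j' (x(j := y))) \<partial>lborel :: ennreal)"
        using nn_integral_real_affine[OF m, of "-1" "1 - sum x I"] by (simp add: chart)
    qed
    also have "\<dots> = emeasure (distr (Pi\<^sub>M (UNIV - {j'}) (\<lambda>_. lborel)) borel (simplex_chart j')) A"
      unfolding em using meas[of j'] I by (simp add: product_nn_integral_insert)
    finally show "emeasure (distr (Pi\<^sub>M (UNIV - {j}) (\<lambda>_. lborel)) borel (simplex_chart j)) A =
        emeasure (distr (Pi\<^sub>M (UNIV - {j'}) (\<lambda>_. lborel)) borel (simplex_chart j')) A" .
  qed simp
  then show ?thesis by (simp add: simplex_lebesgue_via_def)
qed simp

lemma simplex_lebesgue_eq: "simplex_lebesgue = simplex_lebesgue_via j"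
  unfolding simplex_lebesgue_def by (rule simplex_lebesgue_via_indep)

lemma space_simplex_lebesgue: "space simplex_lebesgue = prob_simplex"
  by (simp add: simplex_lebesgue_def simplex_lebesgue_via_def space_restrict_space)

lemma emeasure_simplex_lebesgue:
  "emeasure (simplex_lebesgue :: (real ^ 'k::finite) measure) prob_simplex =
     ennreal (1 / fact (CARD('k) - 1))"
proof -
  fix j :: 'k
  let ?P = "Pi\<^sub>M (UNIV - {j}) (\<lambda>_. lborel :: real measure)"
  have chart: "simplex_chart j x \<in> prob_simplex \<longleftrightarrow>
      (\<forall>i\<in>UNIV - {j}. 0 \<le> x i) \<and> sum x (UNIV - {j}) \<le> 1" (is "?L \<longleftrightarrow> ?R") for x
  proof
    assume L: ?L
    have nn: "0 \<le> simplex_chart j x $ k" for k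
      using L by (simp add: prob_simplex_def)
    have "0 \<le> x i" if "i \<noteq> j" for i
      using nn[of i] that by (simp add: simplex_chart_def)
    then show ?R using nn[of j] by (simp add: simplex_chart_def)
  next
    assume R: ?R
    have s: "(\<Sum>k\<in>UNIV. simplex_chart j x $ k) = 1"
      by (subst sum.remove[of UNIV j]) (auto simp: simplex_chart_def)
    have nn: "0 \<le> simplex_chart j x $ k" for k
      using R by (auto simp: simplex_chart_def)
    have "simplex_chart j x $ k \<le> 1" for k
      using member_le_sum[of k UNIV "\<lambda>k. simplex_chart j x $ k"] nn s by auto
    then show ?L using s nn by (auto simp: prob_simplex_def)
  qed
  let ?D = "distr ?P borel (simplex_chart j)"
  have "prob_simplex \<in> sets (restrict_space ?D prob_simplex)"
    by (simp add: sets_restrict_space_iff)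
  then have "emeasure simplex_lebesgue (prob_simplex :: (real ^ 'k) set) = emeasure ?D prob_simplex"
    unfolding simplex_lebesgue_eq[of j] simplex_lebesgue_via_def
    by (simp add: emeasure_restrict_space)
  also have "\<dots> = emeasure ?P ({x. (\<forall>i\<in>UNIV - {j}. 0 \<le> x i) \<and> sum x (UNIV - {j}) \<le> 1} \<inter> space ?P)"
    by (subst emeasure_distr) (auto simp: chart vimage_def)
  also have "\<dots> = ennreal (1 ^ card (UNIV - {j}) / fact (card (UNIV - {j})))"
    by (rule emeasure_std_simplex_aux) auto
  finally show ?thesis by (simp add: card_Diff_singleton)
qed


section \<open>Prior densities\<close>

definition density_on_simplex :: "(real ^ 'k::finite \<Rightarrow> real) \<Rightarrow> bool" where
  "density_on_simplex f \<longleftrightarrow>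
     f \<in> borel_measurable simplex_lebesgue \<and> (\<forall>p\<in>prob_simplex. 0 \<le> f p) \<and>
     (\<integral>\<^sup>+p. ennreal (f p) \<partial>simplex_lebesgue) = 1"

definition condition_P_at :: "real ^ 'k \<Rightarrow> (real ^ 'k::finite \<Rightarrow> real) \<Rightarrow> bool" where
  "condition_P_at \<alpha> f \<longleftrightarrow>
     uniformly_continuous_on int_simplex (\<lambda>p. f p / (\<Prod>k\<in>UNIV. p $ k powr (\<alpha> $ k - 1))) \<and>
     (\<exists>m>0. \<forall>p\<in>int_simplex. m \<le> f p / (\<Prod>k\<in>UNIV. p $ k powr (\<alpha> $ k - 1)))"

definition condition_P :: "(real ^ 'k::finite \<Rightarrow> real) \<Rightarrow> bool" where
  "condition_P f \<longleftrightarrow> (\<exists>\<alpha>. (\<forall>k. 0 < \<alpha> $ k) \<and> condition_P_at \<alpha> f)"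


section \<open>Tosses of the two dice\<close>

datatype die = Blue | Red

text \<open>\<open>pmf (side_pmf p) k = p $ k\<close> for \<open>p\<close> in the simplex; see \<open>pmf_side_pmf\<close> below.\<close>

definition side_pmf :: "real ^ 'k::finite \<Rightarrow> 'k pmf" where
  "side_pmf p = embed_pmf (\<lambda>k. p $ k)"

lemma pmf_side_pmf: "p \<in> prob_simplex \<Longrightarrow> pmf (side_pmf p) k = p $ k"
  unfolding side_pmf_def
  by (rule pmf_embed_pmf)
     (auto simp: prob_simplex_def nn_integral_count_space_finite simp flip: ennreal_1)

text \<open>The law of the sides shown in periods \<open>1, 2, \<dots>\<close>, where \<open>d t\<close> is the die tossed in period
  \<open>t\<close>; the value \<open>d 0\<close> is irrelevant.\<close>

definition toss_measure ::
    "(nat \<Rightarrow> die) \<Rightarrow> real ^ 'k \<Rightarrow> real ^ 'k \<Rightarrow> (nat \<Rightarrow> 'k::finite) measure" where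
  "toss_measure d p q =
     Pi\<^sub>M {1..} (\<lambda>t. measure_pmf (side_pmf (case d t of Blue \<Rightarrow> p | Red \<Rightarrow> q)))"

definition observations :: "(nat \<Rightarrow> die) \<Rightarrow> nat \<Rightarrow> (nat \<Rightarrow> 'k) \<Rightarrow> (die \<times> 'k) list" where
  "observations d n \<omega> = map (\<lambda>t. (d t, \<omega> t)) [1..<Suc n]"

definition blue_tosses :: "(nat \<Rightarrow> die) \<Rightarrow> nat \<Rightarrow> nat" where
  "blue_tosses d n = card {t\<in>{1..n}. d t = Blue}"

text \<open>\<open>bayes_estimator f c x k\<close> is the posterior mean of the probability of side \<open>k\<close> of the die of
  colour \<open>c\<close>, given the prior density \<open>f\<close> of that die and the observations \<open>x\<close>.\<close>

definition bayes_estimator ::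
    "(real ^ 'k::finite \<Rightarrow> real) \<Rightarrow> die \<Rightarrow> (die \<times> 'k) list \<Rightarrow> 'k \<Rightarrow> real" where
  "bayes_estimator f c x k =
     (LINT p|simplex_lebesgue. p $ k * (\<Prod>i\<in>UNIV. p $ i ^ count_list x (c, i)) * f p) /
     (LINT p|simplex_lebesgue. (\<Prod>i\<in>UNIV. p $ i ^ count_list x (c, i)) * f p)"

end

theory Submission
  imports Defs
begin

text \<open>Write a prior as \<open>g\<close> times the kernel of a Dirichlet distribution, where \<open>g\<close> is uniformly
  continuous and bounded away from zero. Given counts \<open>y\<close> from \<open>n\<close> tosses, the posterior mean of
  \<open>p\<^sub>k\<close> is then the Dirichlet mean \<open>(\<alpha>\<^sub>k + y\<^sub>k) / (|\<alpha>| + n)\<close> times a quotient of two expectations of \<open>g\<close>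
  under Dirichlet distributions whose means are at distance \<open>O(1/n)\<close> and whose variances are \<open>O(1/n)\<close>. That
  quotient tends to 1 uniformly in \<open>y\<close>, so the posterior mean has a uniformly small relative error
  as an approximation of \<open>(\<alpha>\<^sub>k + y\<^sub>k) / (|\<alpha>| + n)\<close>, however rare side \<open>k\<close> is. Chebyshev's inequality
  for the two counts of side \<open>kbar\<close>, with deviations proportional to \<open>b\<^sub>n p\<close> and \<open>(n - b\<^sub>n) p / c\<close>,
  finishes the proof.\<close>


section \<open>Dirichlet integrals\<close>

text \<open>Substituting \<open>y = s * t\<close> yields the beta integral on the unit interval; the
  power of \<open>s\<close> collects the Jacobian and the two factors.\<close>

lemma nn_integral_beta_scaled:
  fixes a b s :: real
  assumes a: "0 < a" and b: "0 < b" and s: "0 < s"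
  shows "(\<integral>\<^sup>+y. ennreal (y powr (a - 1) * (s - y) powr (b - 1)) * indicator {0..s} y \<partial>lborel)
       = ennreal (s powr (a + b - 1) * Beta a b)"
proof -
  have unit: "(\<integral>\<^sup>+t. ennreal (t powr (a - 1) * (1 - t) powr (b - 1)) * indicator {0..1} t \<partial>lborel)
      = ennreal (Beta a b)"
    by (rule nn_integral_has_integral_lebesgue'[OF _ has_integral_Beta_real[OF a b]]) auto
  have "(\<integral>\<^sup>+y. ennreal (y powr (a - 1) * (s - y) powr (b - 1)) * indicator {0..s} y \<partial>lborel)
    = \<bar>s\<bar> * (\<integral>\<^sup>+t. ennreal ((0 + s * t) powr (a - 1) * (s - (0 + s * t)) powr (b - 1))
          * indicator {0..s} (0 + s * t) \<partial>lborel)"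
    using s by (intro nn_integral_real_affine) auto
  also have "(\<integral>\<^sup>+t. ennreal ((0 + s * t) powr (a - 1) * (s - (0 + s * t)) powr (b - 1))
          * indicator {0..s} (0 + s * t) \<partial>lborel)
     = (\<integral>\<^sup>+t. ennreal (s powr (a + b - 2)) * (ennreal (t powr (a - 1) * (1 - t) powr (b - 1)) * indicator {0..1} t) \<partial>lborel)"
  proof (rule nn_integral_cong)
    fix t :: real
    have "(s * t) powr (a - 1) * (s - s * t) powr (b - 1)
       = s powr (a + b - 2) * (t powr (a - 1) * (1 - t) powr (b - 1))" if "0 \<le> t" "t \<le> 1"
    proof -
      have "s - s * t = s * (1 - t)" by (simp add: algebra_simps)
      moreover have "s powr (a + b - 2) = s powr (a - 1) * s powr (b - 1)"
        by (simp flip: powr_add)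
      ultimately show ?thesis using that s
        by (simp add: powr_mult)
    qed
    moreover have "s * t \<le> s \<longleftrightarrow> t \<le> 1" "0 \<le> s * t \<longleftrightarrow> 0 \<le> t"
      using s by (auto simp: zero_le_mult_iff)
    ultimately show "ennreal ((0 + s * t) powr (a - 1) * (s - (0 + s * t)) powr (b - 1))
          * indicator {0..s} (0 + s * t)
      = ennreal (s powr (a + b - 2)) * (ennreal (t powr (a - 1) * (1 - t) powr (b - 1)) * indicator {0..1} t)"
      by (auto simp: indicator_def simp flip: ennreal_mult')
  qed
  also have "\<dots> = ennreal (s powr (a + b - 2)) * ennreal (Beta a b)"
    by (subst nn_integral_cmult) (auto simp: unit)
  also have "ennreal \<bar>s\<bar> * \<dots> = ennreal (s * (s powr (a + b - 2) * Beta a b))"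
    using s by (simp add: ennreal_mult' mult.assoc)
  also have "s * (s powr (a + b - 2) * Beta a b) = s powr (a + b - 1) * Beta a b"
    using s powr_mult_base[of s "a + b - 2"] by simp
  finally show ?thesis .
qed

text \<open>For positive \<open>s\<close> the extra factor raises one exponent by one, and
  \<open>b * Beta (a + 1) b = a * Beta a (b + 1)\<close>. Nonpositive \<open>s\<close> is included
  because \<open>s\<close> will be one minus the sum of the other coordinates, which can have any
  sign outside the simplex; both integrands vanish then.\<close>

lemma nn_integral_beta_exchange:
  fixes a b s :: real
  assumes a: "0 < a" and b: "0 < b"
  shows "ennreal b * (\<integral>\<^sup>+y. ennreal (y * (y powr (a - 1) * (s - y) powr (b - 1))) * indicator {0..s} y \<partial>lborel)
       = ennreal a * (\<integral>\<^sup>+y. ennreal ((s - y) * (y powr (a - 1) * (s - y) powr (b - 1))) * indicator {0..s} y \<partial>lborel)"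
proof (cases "0 < s")
  case True
  have "(\<integral>\<^sup>+y. ennreal (y * (y powr (a - 1) * (s - y) powr (b - 1))) * indicator {0..s} y \<partial>lborel)
      = (\<integral>\<^sup>+y. ennreal (y powr (a + 1 - 1) * (s - y) powr (b - 1)) * indicator {0..s} y \<partial>lborel)"
    using a by (intro nn_integral_cong) (auto simp: indicator_def powr_mult_base simp flip: mult.assoc)
  moreover have "(\<integral>\<^sup>+y. ennreal ((s - y) * (y powr (a - 1) * (s - y) powr (b - 1))) * indicator {0..s} y \<partial>lborel)
      = (\<integral>\<^sup>+y. ennreal (y powr (a - 1) * (s - y) powr (b + 1 - 1)) * indicator {0..s} y \<partial>lborel)"
    using b by (intro nn_integral_cong) (auto simp: indicator_def powr_mult_base mult.left_commute)
  moreover have "b * Beta (a + 1) b = a * Beta a (b + 1)"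
  proof -
    have "a \<notin> \<int>\<^sub>\<le>\<^sub>0" "b \<notin> \<int>\<^sub>\<le>\<^sub>0" using a b nonpos_Ints_nonpos by force+
    \<comment> \<open>Both sides equal \<open>a * b * Beta a b\<close>.\<close>
    then have "(a + b) * (b * Beta (a + 1) b) = (a + b) * (a * Beta a (b + 1))"
      using Beta_plus1_left[of a b] Beta_plus1_right[of b a] by (simp add: mult.left_commute)
    then show ?thesis using a b by simp
  qed
  ultimately show ?thesis
    using nn_integral_beta_scaled[of "a + 1" b s] nn_integral_beta_scaled[of a "b + 1" s] a b True
    by (simp add: add_ac mult.left_commute[of _ "s powr _"] flip: ennreal_mult')
next
  case False
  then have "ennreal (y * (y powr (a - 1) * (s - y) powr (b - 1))) * indicator {0..s} y = 0"
    and "ennreal ((s - y) * (y powr (a - 1) * (s - y) powr (b - 1))) * indicator {0..s} y = 0" for y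
    by (auto simp: indicator_def)
  then show ?thesis by (simp only: nn_integral_const mult_zero_left mult_zero_right)
qed

section \<open>Integration over the simplex in coordinates\<close>

lemma nn_integral_simplex_lebesgue:
  fixes h :: "real ^ 'k::finite \<Rightarrow> ennreal"
  assumes [measurable]: "h \<in> borel_measurable borel"
  shows "(\<integral>\<^sup>+p. h p \<partial>simplex_lebesgue) =
    (\<integral>\<^sup>+x. h (simplex_chart j x) * indicator prob_simplex (simplex_chart j x) \<partial>Pi\<^sub>M (UNIV - {j}) (\<lambda>_. lborel))"
  unfolding simplex_lebesgue_eq[of j] simplex_lebesgue_via_def nn_integral_completion
  by (subst nn_integral_restrict_space) (auto simp: nn_integral_distr)

lemma prob_simplex_iff:
  "(p :: real ^ 'k::finite) \<in> prob_simplex \<longleftrightarrow> (\<forall>k. 0 \<le> p $ k) \<and> (\<Sum>k\<in>UNIV. p $ k) = 1"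
  using member_le_sum[of _ UNIV "\<lambda>k. p $ k"] by (auto simp: prob_simplex_def)

text \<open>Tonelli in the chart omitting \<open>j\<close>, with coordinate \<open>k\<close>
  innermost: along each inner line only \<open>p $ k\<close> and \<open>p $ j\<close> vary, and
  their sum is fixed. Statements about two coordinates become one-dimensional in this way.\<close>

lemma nn_integral_simplex_lebesgue_insert:
  fixes h :: "real ^ 'k::finite \<Rightarrow> ennreal"
  assumes [measurable]: "h \<in> borel_measurable borel" and jk: "j \<noteq> k"
  shows "(\<integral>\<^sup>+p. h p \<partial>simplex_lebesgue) =
    (\<integral>\<^sup>+x. \<integral>\<^sup>+y. h (\<chi> i. if i = k then y else if i = j then 1 - sum x (UNIV - {j, k}) - y else x i)
       * indicator {0..1 - sum x (UNIV - {j, k})} y * indicator {x. \<forall>i\<in>UNIV - {j, k}. 0 \<le> x i} x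
      \<partial>lborel \<partial>Pi\<^sub>M (UNIV - {j, k}) (\<lambda>_. lborel))"
proof -
  interpret product_sigma_finite "\<lambda>_::'k. lborel :: real measure" by standard
  define I where "I = UNIV - {j, k}"
  have I: "UNIV - {j} = insert k I" "k \<notin> I" "j \<notin> I" "finite I" "UNIV = insert j (insert k I)"
    using jk by (auto simp: I_def)
  let ?v = "\<lambda>x y. (\<chi> i. if i = k then y else if i = j then 1 - sum x I - y else x i) :: real ^ 'k"
  have chart: "simplex_chart j (x(k := y)) = ?v x y" for x y
    using I jk unfolding simplex_chart_def vec_eq_iff I(1)
    by (auto simp: fun_upd_def if_distrib intro!: sum.cong)
  have sv: "(\<Sum>i\<in>UNIV. ?v x y $ i) = 1" for x y
  proof -
    have "(\<Sum>i\<in>I. ?v x y $ i) = sum x I"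
      using I by (intro sum.cong) auto
    then show ?thesis
      unfolding I(5) using I(2-4) jk by simp
  qed
  have "?v x y \<in> prob_simplex \<longleftrightarrow> y \<in> {0..1 - sum x I} \<and> (\<forall>i\<in>I. 0 \<le> x i)" for x y
    unfolding prob_simplex_iff sv using jk I(2,3)
    by (auto simp: I_def)
  then have ind: "indicator prob_simplex (?v x y) =
      (indicator {0..1 - sum x I} y * indicator {x. \<forall>i\<in>I. 0 \<le> x i} x :: ennreal)" for x y
    by (auto simp: indicator_def)
  have "(\<lambda>x. h (simplex_chart j x) * indicator prob_simplex (simplex_chart j x)) \<in> borel_measurable (Pi\<^sub>M (UNIV - {j}) (\<lambda>_. lborel))"
    by measurable
  then show ?thesis
    unfolding nn_integral_simplex_lebesgue[OF assms(1), of j] I(1) I_def[symmetric]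
    using I by (subst product_nn_integral_insert) (auto simp: chart ind mult.assoc)
qed

lemma borel_measurable_simplex_lebesgue:
  "h \<in> borel_measurable borel \<Longrightarrow> h \<in> borel_measurable (simplex_lebesgue :: (real ^ 'k::finite) measure)"
  unfolding simplex_lebesgue_def simplex_lebesgue_via_def
  by (intro measurable_completion measurable_restrict_space1) simp

section \<open>Dirichlet kernels and their moments\<close>

text \<open>The unnormalised Dirichlet density with parameter vector \<open>b\<close>. Since
  \<open>0 powr a = 0\<close> for every \<open>a\<close>, it vanishes at simplex points with a zero
  coordinate, even where the density would blow up.\<close>

definition dirichlet_kernel :: "real ^ 'k::finite \<Rightarrow> real ^ 'k \<Rightarrow> real" where
  "dirichlet_kernel b p = (\<Prod>i\<in>UNIV. p $ i powr (b $ i - 1))"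

lemma dirichlet_kernel_measurable [measurable]: "dirichlet_kernel b \<in> borel_measurable borel"
  unfolding dirichlet_kernel_def[abs_def] by measurable

lemma dirichlet_kernel_nonneg [simp]: "0 \<le> dirichlet_kernel b p"
  by (simp add: dirichlet_kernel_def prod_nonneg)

text \<open>First moments are proportional to the parameters; as the coordinates add up to one, this
  will determine them relative to the total mass.\<close>

lemma nn_integral_dirichlet_exchange:
  fixes b :: "real ^ 'k::finite"
  assumes b: "\<And>i. 0 < b $ i"
  shows "ennreal (b $ j) * (\<integral>\<^sup>+p. ennreal (p $ k * dirichlet_kernel b p) \<partial>simplex_lebesgue)
       = ennreal (b $ k) * (\<integral>\<^sup>+p. ennreal (p $ j * dirichlet_kernel b p) \<partial>simplex_lebesgue)"
proof (cases "j = k")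
  case False
  txt \<open>With the coordinates other than \<open>j\<close> and \<open>k\<close> fixed, both sides are one-dimensional beta integrals.\<close>
  define I where "I = UNIV - {j, k}"
  have I: "k \<notin> I" "j \<notin> I" "finite I" "UNIV = insert j (insert k I)"
    using False by (auto simp: I_def)
  let ?v = "\<lambda>x y. (\<chi> i. if i = k then y else if i = j then 1 - sum x I - y else x i) :: real ^ 'k"
  let ?R = "\<lambda>x. \<Prod>i\<in>I. x i powr (b $ i - 1)"
  let ?P = "Pi\<^sub>M I (\<lambda>_. lborel :: real measure)"
  let ?C = "{x. \<forall>i\<in>I. 0 \<le> x i}"
  let ?F = "\<lambda>l x y. ennreal ((?v x y $ l) * (y powr (b $ k - 1) * ((1 - sum x I) - y) powr (b $ j - 1)))
    * indicator {0..1 - sum x I} y"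
  have ker: "dirichlet_kernel b (?v x y) =
      ?R x * (y powr (b $ k - 1) * ((1 - sum x I) - y) powr (b $ j - 1))" for x y
  proof -
    have "(\<Prod>i\<in>I. ?v x y $ i powr (b $ i - 1)) = ?R x"
      using I by (intro prod.cong) auto
    then show ?thesis
      unfolding dirichlet_kernel_def I(4) using I(1-3) False by simp
  qed
  have *: "(\<integral>\<^sup>+p. ennreal (p $ l * dirichlet_kernel b p) \<partial>simplex_lebesgue) =
     (\<integral>\<^sup>+x. ennreal (?R x) * indicator ?C x * (\<integral>\<^sup>+y. ?F l x y \<partial>lborel) \<partial>?P)" if l: "l = j \<or> l = k" for l
  proof -
    have vl: "?v x y $ l = (if l = k then y else 1 - sum x I - y)" for x y
      using l by auto
    have "(\<integral>\<^sup>+y. ennreal ((?v x y $ l) * dirichlet_kernel b (?v x y)) * indicator {0..1 - sum x I} y * indicator ?C x \<partial>lborel)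
      = ennreal (?R x) * indicator ?C x * (\<integral>\<^sup>+y. ?F l x y \<partial>lborel)" for x
    proof -
      have "(\<integral>\<^sup>+y. ennreal ((?v x y $ l) * dirichlet_kernel b (?v x y)) * indicator {0..1 - sum x I} y * indicator ?C x \<partial>lborel)
       = (\<integral>\<^sup>+y. (ennreal (?R x) * indicator ?C x) * (?F l x y) \<partial>lborel)"
      proof (rule nn_integral_cong)
        fix y :: real
        have R: "ennreal (u * (?R x * t)) = ennreal (?R x) * ennreal (u * t)" for u t :: real
          by (subst ennreal_mult'[symmetric]) (simp_all add: prod_nonneg mult.left_commute)
        show "ennreal ((?v x y $ l) * dirichlet_kernel b (?v x y)) * indicator {0..1 - sum x I} y * indicator ?C x
          = (ennreal (?R x) * indicator ?C x) * (?F l x y)"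
          unfolding ker R by (simp only: mult_ac)
      qed
      also have "\<dots> = ennreal (?R x) * indicator ?C x * (\<integral>\<^sup>+y. ?F l x y \<partial>lborel)"
        unfolding vl by (rule nn_integral_cmult) measurable
      finally show ?thesis .
    qed
    note inner = this
    have m: "(\<lambda>p. ennreal (p $ l * dirichlet_kernel b p)) \<in> borel_measurable borel"
      by measurable
    show ?thesis
      unfolding nn_integral_simplex_lebesgue_insert[OF m False] I_def[symmetric]
      by (intro nn_integral_cong) (rule inner)
  qed
  have meas: "(\<lambda>x. ennreal (?R x) * indicator ?C x * (\<integral>\<^sup>+y. ?F l x y \<partial>lborel)) \<in> borel_measurable ?P" if l: "l = j \<or> l = k" for l
  proof -
    \<comment> \<open>\<open>?C\<close> also contains functions outside the space of
      \<open>?P\<close>, so measurability is first shown for its trace on the space.\<close>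
    have "Measurable.pred ?P (\<lambda>x. \<forall>i\<in>I. 0 \<le> x i)"
      using I(3) by measurable
    then have "(indicator {x \<in> space ?P. \<forall>i\<in>I. 0 \<le> x i} :: _ \<Rightarrow> ennreal) \<in> borel_measurable ?P"
      by (intro borel_measurable_indicator) (simp add: pred_def)
    then have C: "(\<lambda>x. indicator ?C x :: ennreal) \<in> borel_measurable ?P"
      by (rule measurable_cong[THEN iffD1, rotated]) (auto simp: indicator_def)
    have ind: "indicator {0..1 - sum x I} y = (if 0 \<le> y \<and> y \<le> 1 - sum x I then 1 else 0 :: ennreal)" for x y
      by (simp add: indicator_def)
    have vl: "?v x y $ l = (if l = k then y else 1 - sum x I - y)" for x y
      using l by auto
    \<comment> \<open>The inner integral is measurable in \<open>x\<close> because its integrand is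
      jointly measurable in both variables.\<close>
    have "(\<lambda>z. ennreal ((if l = k then snd z else 1 - sum (fst z) I - snd z) * (snd z powr (b $ k - 1) * ((1 - sum (fst z) I) - snd z) powr (b $ j - 1)))
        * (if 0 \<le> snd z \<and> snd z \<le> 1 - sum (fst z) I then 1 else 0)) \<in> borel_measurable (?P \<Otimes>\<^sub>M lborel)"
      by measurable
    then have "(\<lambda>x. \<integral>\<^sup>+y. ?F l x y \<partial>lborel) \<in> borel_measurable ?P"
      unfolding ind vl by (intro lborel.borel_measurable_nn_integral) (simp add: split_beta')
    moreover have "(\<lambda>x. ennreal (?R x)) \<in> borel_measurable ?P"
      by measurable
    ultimately show ?thesis
      using C by (intro borel_measurable_times_ennreal)
  qed
  show ?thesis
    unfolding *[OF disjI1[OF refl]] *[OF disjI2[OF refl]]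
      nn_integral_cmult[OF meas[OF disjI1[OF refl]], symmetric]
      nn_integral_cmult[OF meas[OF disjI2[OF refl]], symmetric]
  proof (rule nn_integral_cong)
    fix x :: "'k \<Rightarrow> real"
    show "ennreal (b $ j) * (ennreal (?R x) * indicator ?C x * (\<integral>\<^sup>+y. ?F k x y \<partial>lborel))
      = ennreal (b $ k) * (ennreal (?R x) * indicator ?C x * (\<integral>\<^sup>+y. ?F j x y \<partial>lborel))"
      using nn_integral_beta_exchange[OF b[of k] b[of j], of "1 - sum x I"] False
      by (simp add: mult.left_commute[of "ennreal (b $ j)"] mult.left_commute[of "ennreal (b $ k)"])
  qed
qed simp

text \<open>As there is a second side \<open>j\<close>, the coordinate \<open>p $ k\<close> can
  serve as the inner integration variable, and its zero set is a single point of the line.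
  Properties known only on \<open>int_simplex\<close>, such as those in Condition P, thus become
  usable under integrals.\<close>

lemma AE_simplex_pos:
  assumes K: "CARD('k::finite) \<ge> 2"
  shows "AE p in (simplex_lebesgue :: (real ^ 'k) measure). p \<in> int_simplex"
proof -
  have "AE p in (simplex_lebesgue :: (real ^ 'k) measure). p $ k \<noteq> 0" for k
  proof -
    obtain j where j: "j \<noteq> k"
      using K by (metis card_2_iff' ex_card subset_UNIV insertCI)
    have "(\<integral>\<^sup>+p. indicator {p. p $ k = 0} p \<partial>(simplex_lebesgue :: (real ^ 'k) measure)) = 0"
    proof (subst nn_integral_simplex_lebesgue_insert[OF _ j])
      show "(indicator {p. p $ k = 0} :: real ^ 'k \<Rightarrow> ennreal) \<in> borel_measurable borel"
        by measurable
      have "(\<integral>\<^sup>+y. indicator {p. p $ k = 0} ((\<chi> i. if i = k then y else if i = j then c - y else x i) :: real ^ 'k)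
           * f y * e \<partial>lborel) = 0" for c x e and f :: "real \<Rightarrow> ennreal"
      proof -
        have "AE y in lborel. y \<noteq> (0::real)" by (rule AE_lborel_singleton)
        then have "AE y in lborel. indicator {p. p $ k = 0} ((\<chi> i. if i = k then y else if i = j then c - y else x i) :: real ^ 'k)
           * f y * e = 0" by (auto elim!: eventually_mono)
        then show ?thesis by (subst nn_integral_cong_AE) auto
      qed
      then show "(\<integral>\<^sup>+x. \<integral>\<^sup>+y. indicator {p. p $ k = 0} ((\<chi> i. if i = k then y else if i = j then 1 - sum x (UNIV - {j, k}) - y else x i) :: real ^ 'k)
       * indicator {0..1 - sum x (UNIV - {j, k})} y * indicator {x. \<forall>i\<in>UNIV - {j, k}. 0 \<le> x i} x
      \<partial>lborel \<partial>Pi\<^sub>M (UNIV - {j, k}) (\<lambda>_. lborel)) = 0"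
        by simp
    qed
    then show ?thesis
      by (subst (asm) nn_integral_0_iff_AE) (auto intro!: borel_measurable_simplex_lebesgue simp: indicator_def split: if_splits elim!: eventually_mono)
  qed
  then have "AE p in (simplex_lebesgue :: (real ^ 'k) measure). \<forall>k. p $ k \<noteq> 0"
    by (simp add: AE_all_countable)
  then show ?thesis
    using AE_space[of "simplex_lebesgue :: (real ^ 'k) measure"]
  proof eventually_elim
    case (elim p)
    then show ?case
      by (auto simp: int_simplex_def space_simplex_lebesgue prob_simplex_def order.strict_iff_order)
  qed
qed

lemma dirichlet_kernel_pos: "p \<in> int_simplex \<Longrightarrow> 0 < dirichlet_kernel b p"
  unfolding dirichlet_kernel_def by (intro prod_pos) (simp add: int_simplex_def less_imp_neq[THEN not_sym])

text \<open>Multiplication by a coordinate raises one parameter by one, so moments are total masses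
  of shifted kernels. At \<open>p $ k = 0\<close> both sides vanish because
  \<open>0 powr a = 0\<close>.\<close>

lemma dirichlet_kernel_axis:
  assumes "0 \<le> p $ k"
  shows "dirichlet_kernel (b + axis k 1) p = p $ k * dirichlet_kernel b p"
proof -
  have "(\<Prod>i\<in>UNIV - {k}. p $ i powr ((b + axis k 1) $ i - 1)) = (\<Prod>i\<in>UNIV - {k}. p $ i powr (b $ i - 1))"
    by (intro prod.cong) (auto simp: axis_def)
  moreover have "p $ k powr (b $ k) = p $ k * p $ k powr (b $ k - 1)"
    using assms powr_mult_base[of "p $ k" "b $ k - 1"] by simp
  ultimately show ?thesis
    unfolding dirichlet_kernel_def
    by (simp add: prod.remove[of UNIV k])
qed

lemma borel_measurable_dirichlet_kernel_simplex [measurable]: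
  "dirichlet_kernel b \<in> borel_measurable simplex_lebesgue"
  by (intro borel_measurable_simplex_lebesgue) measurable

lemma borel_measurable_nth_simplex [measurable]:
  "(\<lambda>p. p $ k) \<in> borel_measurable (simplex_lebesgue :: (real ^ 'k::finite) measure)"
  by (intro borel_measurable_simplex_lebesgue) measurable

lemma AE_simplex: "AE p in (simplex_lebesgue :: (real ^ 'k::finite) measure). p \<in> prob_simplex"
  using AE_space[of "simplex_lebesgue :: (real ^ 'k) measure"] by (simp add: space_simplex_lebesgue)

lemma integrable_nth_times:
  fixes f :: "real ^ 'k::finite \<Rightarrow> real"
  assumes "integrable simplex_lebesgue f"
  shows "integrable simplex_lebesgue (\<lambda>p. p $ k * f p)"
proof (rule Bochner_Integration.integrable_bound[OF assms])
  show "(\<lambda>p. p $ k * f p) \<in> borel_measurable simplex_lebesgue"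
    using assms by measurable
  show "AE p in simplex_lebesgue. norm (p $ k * f p) \<le> norm (f p)"
    using AE_simplex
    by eventually_elim (auto simp: prob_simplex_def abs_mult intro!: mult_left_le_one_le)
qed

lemma integrable_dirichlet_kernel_axis:
  fixes b :: "real ^ 'k::finite"
  assumes "integrable simplex_lebesgue (dirichlet_kernel b)"
  shows "integrable simplex_lebesgue (dirichlet_kernel (b + axis k 1))"
  using integrable_nth_times[OF assms, of k]
  by (rule integrable_cong_AE_imp)
    (use AE_simplex in \<open>auto elim!: eventually_mono simp: dirichlet_kernel_axis prob_simplex_def\<close>)

text \<open>By the exchange relation the first moments \<open>E k\<close> are proportional to
  \<open>b $ k\<close>, and they add up to the total mass because the coordinates of
  \<open>p\<close> add up to one.\<close>

lemma integral_dirichlet_kernel_axis: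
  fixes b :: "real ^ 'k::finite"
  assumes b: "\<And>i. 0 < b $ i" and int: "integrable simplex_lebesgue (dirichlet_kernel b)"
  shows "(LINT p|simplex_lebesgue. dirichlet_kernel (b + axis k 1) p)
       = b $ k / (\<Sum>i\<in>UNIV. b $ i) * (LINT p|simplex_lebesgue. dirichlet_kernel b p)"
proof -
  define E where "E k = (LINT p|simplex_lebesgue. p $ k * dirichlet_kernel b p)" for k
  have nn: "(\<integral>\<^sup>+p. ennreal (p $ k * dirichlet_kernel b p) \<partial>simplex_lebesgue) = ennreal (E k)" for k
    unfolding E_def
    by (intro nn_integral_eq_integral integrable_nth_times int)
      (use AE_simplex in \<open>auto elim!: eventually_mono simp: prob_simplex_def\<close>)
  have E0: "0 \<le> E k" for k
    unfolding E_def
    by (intro integral_nonneg_AE) (use AE_simplex in \<open>auto elim!: eventually_mono simp: prob_simplex_def\<close>)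
  have ex: "b $ j * E k = b $ k * E j" for j k
    using nn_integral_dirichlet_exchange[OF b, of j k] b[of j] b[of k] E0
    by (simp add: nn less_imp_le flip: ennreal_mult)
  have "(\<Sum>j\<in>UNIV. E j) = (LINT p|simplex_lebesgue. (\<Sum>j\<in>UNIV. p $ j * dirichlet_kernel b p))"
    unfolding E_def by (subst Bochner_Integration.integral_sum) (auto intro: integrable_nth_times int)
  also have "\<dots> = (LINT p|simplex_lebesgue. dirichlet_kernel b p)"
    by (intro integral_cong_AE)
      (use AE_simplex in \<open>auto elim!: eventually_mono simp: prob_simplex_def simp flip: sum_distrib_right\<close>)
  finally have sumE: "(\<Sum>j\<in>UNIV. E j) = (LINT p|simplex_lebesgue. dirichlet_kernel b p)" .
  have "(\<Sum>j\<in>UNIV. b $ j) * E k = b $ k * (\<Sum>j\<in>UNIV. E j)"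
    by (simp add: sum_distrib_left sum_distrib_right ex)
  moreover have "0 < (\<Sum>j\<in>UNIV. b $ j)"
    by (intro sum_pos b) auto
  moreover have "(LINT p|simplex_lebesgue. dirichlet_kernel (b + axis k 1) p) = E k"
    unfolding E_def
    by (intro integral_cong_AE)
      (use AE_simplex in \<open>auto elim!: eventually_mono simp: dirichlet_kernel_axis prob_simplex_def\<close>)
  ultimately show ?thesis
    by (simp add: sumE field_simps)
qed

text \<open>Variance plus squared bias: the Dirichlet mean is \<open>b /\<^sub>R B\<close>, and the
  coordinate variances add up to at most \<open>1 / B\<close>. A general centre \<open>m\<close>
  allows different parameter vectors to be compared with one and the same point.\<close>

lemma dirichlet_second_moment:
  fixes b m :: "real ^ 'k::finite"
  assumes b: "\<And>i. 0 < b $ i" and int: "integrable simplex_lebesgue (dirichlet_kernel b)"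
  defines "B \<equiv> (\<Sum>i\<in>UNIV. b $ i)"
  shows "integrable simplex_lebesgue (\<lambda>p. (norm (p - m))\<^sup>2 * dirichlet_kernel b p)" (is ?int)
    and "(LINT p|simplex_lebesgue. (norm (p - m))\<^sup>2 * dirichlet_kernel b p)
       \<le> (1 / B + (norm (b /\<^sub>R B - m))\<^sup>2) * (LINT p|simplex_lebesgue. dirichlet_kernel b p)" (is ?le)
proof -
  let ?w = "dirichlet_kernel b"
  let ?D = "LINT p|simplex_lebesgue. ?w p"
  have B: "0 < B" unfolding B_def by (intro sum_pos b) auto
  have D: "0 \<le> ?D" by (intro Bochner_Integration.integral_nonneg) auto
  have nsq: "(norm x)\<^sup>2 = (\<Sum>i\<in>UNIV. (x $ i)\<^sup>2)" for x :: "real ^ 'k"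
    by (simp add: norm_vec_def L2_set_def sum_nonneg)
  have expand: "(norm (p - m))\<^sup>2 * ?w p =
      (\<Sum>i\<in>UNIV. p $ i * (p $ i * ?w p) - 2 * m $ i * (p $ i * ?w p) + (m $ i)\<^sup>2 * ?w p)" for p
    unfolding nsq sum_distrib_right
    by (intro sum.cong) (auto simp: power2_eq_square algebra_simps)
  have i1: "integrable simplex_lebesgue (\<lambda>p. p $ i * ?w p)"
    and i2: "integrable simplex_lebesgue (\<lambda>p. p $ i * (p $ i * ?w p))" for i
    by (intro integrable_nth_times int)+
  have i3: "integrable simplex_lebesgue (\<lambda>p. p $ i * (p $ i * ?w p) - 2 * m $ i * (p $ i * ?w p) + (m $ i)\<^sup>2 * ?w p)" for i
    using i1[of i] i2[of i] int by (intro Bochner_Integration.integrable_add Bochner_Integration.integrable_diff integrable_mult_right) auto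
  show ?int
    unfolding expand by (intro Bochner_Integration.integrable_sum i3)
  have m1: "(LINT p|simplex_lebesgue. p $ i * ?w p) = b $ i / B * ?D" for i
  proof -
    have "(LINT p|simplex_lebesgue. p $ i * ?w p) = (LINT p|simplex_lebesgue. dirichlet_kernel (b + axis i 1) p)"
      by (intro integral_cong_AE)
        (use AE_simplex in \<open>auto elim!: eventually_mono simp: dirichlet_kernel_axis prob_simplex_def\<close>)
    then show ?thesis
      using integral_dirichlet_kernel_axis[OF b int] by (simp add: B_def)
  qed
  \<comment> \<open>The second shift starts from the parameter \<open>b $ i + 1\<close> and the
    total \<open>B + 1\<close>, hence the first factor.\<close>
  have m2: "(LINT p|simplex_lebesgue. p $ i * (p $ i * ?w p)) = (b $ i + 1) / (B + 1) * (b $ i / B * ?D)" for i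
  proof -
    have "(LINT p|simplex_lebesgue. p $ i * (p $ i * ?w p)) = (LINT p|simplex_lebesgue. dirichlet_kernel (b + axis i 1 + axis i 1) p)"
    proof (intro integral_cong_AE)
      show "AE p in simplex_lebesgue. p $ i * (p $ i * ?w p) = dirichlet_kernel (b + axis i 1 + axis i 1) p"
        using AE_simplex
      proof eventually_elim
        case (elim p)
        then have "0 \<le> p $ i" by (simp add: prob_simplex_def)
        then show ?case by (simp only: dirichlet_kernel_axis)
      qed
    qed measurable
    also have "\<dots> = (b $ i + 1) / (B + 1) * (LINT p|simplex_lebesgue. dirichlet_kernel (b + axis i 1) p)"
    proof (subst integral_dirichlet_kernel_axis)
      show "0 < (b + axis i 1) $ j" for j
        using b[of j] by (auto simp: axis_def)
      show "integrable simplex_lebesgue (dirichlet_kernel (b + axis i 1))"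
        by (intro integrable_dirichlet_kernel_axis int)
    qed (simp add: sum.distrib B_def axis_def)
    finally show ?thesis
      using integral_dirichlet_kernel_axis[OF b int] by (simp add: B_def)
  qed
  have "(LINT p|simplex_lebesgue. (norm (p - m))\<^sup>2 * ?w p) =
     (\<Sum>i\<in>UNIV. (b $ i + 1) / (B + 1) * (b $ i / B * ?D) - 2 * m $ i * (b $ i / B * ?D) + (m $ i)\<^sup>2 * ?D)"
    unfolding expand using i1 i2 int i3 by (simp add: m1 m2)
  also have "\<dots> = (\<Sum>i\<in>UNIV. (b $ i + 1) / (B + 1) * (b $ i / B) - 2 * m $ i * (b $ i / B) + (m $ i)\<^sup>2) * ?D"
    unfolding sum_distrib_right distrib_right left_diff_distrib by (simp add: mult.assoc)
  also have "\<dots> \<le> (1 / B + (norm (b /\<^sub>R B - m))\<^sup>2) * ?D"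
  proof (rule mult_right_mono[OF _ D])
    \<comment> \<open>Lowering the denominator \<open>B + 1\<close> to \<open>B\<close> bounds the
      second moment by the squared mean plus the mean over \<open>B\<close>. The means
      \<open>b $ i / B\<close> add up to one, so the excess adds up to \<open>1 / B\<close>.\<close>
    have "(b $ i + 1) / (B + 1) * (b $ i / B) - 2 * m $ i * (b $ i / B) + (m $ i)\<^sup>2
        \<le> b $ i / B / B + (b $ i / B - m $ i)\<^sup>2" for i
    proof -
      have "(b $ i + 1) / (B + 1) \<le> b $ i / B + 1 / B"
        using B b[of i] by (simp add: field_simps)
      then have "(b $ i + 1) / (B + 1) * (b $ i / B) \<le> (b $ i / B + 1 / B) * (b $ i / B)"
        using B b[of i] by (intro mult_right_mono) auto
      then show ?thesis by (simp add: power2_eq_square algebra_simps)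
    qed
    then have "(\<Sum>i\<in>UNIV. (b $ i + 1) / (B + 1) * (b $ i / B) - 2 * m $ i * (b $ i / B) + (m $ i)\<^sup>2)
        \<le> (\<Sum>i\<in>UNIV. b $ i / B / B + (b $ i / B - m $ i)\<^sup>2)"
      by (intro sum_mono)
    also have "\<dots> = 1 / B + (norm (b /\<^sub>R B - m))\<^sup>2"
      using B by (simp add: nsq sum.distrib divide_inverse mult.commute flip: sum_distrib_left sum_divide_distrib B_def)
    finally show "(\<Sum>i\<in>UNIV. (b $ i + 1) / (B + 1) * (b $ i / B) - 2 * m $ i * (b $ i / B) + (m $ i)\<^sup>2)
        \<le> 1 / B + (norm (b /\<^sub>R B - m))\<^sup>2" .
  qed
  finally show ?le .
qed

text \<open>Chebyshev's argument: \<open>|g p - g m|\<close> is at most \<open>\<epsilon>\<close> near \<open>m\<close>, and at most \<open>2 G |p - m|\<^sup>2 / r\<^sup>2\<close>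
  away from it.\<close>

lemma dirichlet_integral_approx:
  fixes b m :: "real ^ 'k::finite" and g :: "real ^ 'k \<Rightarrow> real"
  assumes K: "CARD('k) \<ge> 2"
    and b: "\<And>i. 0 < b $ i" and int: "integrable simplex_lebesgue (dirichlet_kernel b)"
    and g [measurable]: "g \<in> borel_measurable simplex_lebesgue"
    and G: "\<And>p. p \<in> int_simplex \<Longrightarrow> \<bar>g p\<bar> \<le> G"
    and \<epsilon>: "0 \<le> \<epsilon>" and r: "0 < r"
    and uc: "\<And>p p'. p \<in> int_simplex \<Longrightarrow> p' \<in> int_simplex \<Longrightarrow> norm (p - p') < r \<Longrightarrow> \<bar>g p - g p'\<bar> \<le> \<epsilon>"
    and m: "m \<in> int_simplex"
  defines "B \<equiv> (\<Sum>i\<in>UNIV. b $ i)"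
  shows "\<bar>(LINT p|simplex_lebesgue. g p * dirichlet_kernel b p)
       - g m * (LINT p|simplex_lebesgue. dirichlet_kernel b p)\<bar>
     \<le> (\<epsilon> + 2 * G / r\<^sup>2 * (1 / B + (norm (b /\<^sub>R B - m))\<^sup>2)) * (LINT p|simplex_lebesgue. dirichlet_kernel b p)"
proof -
  let ?w = "dirichlet_kernel b"
  let ?D = "LINT p|simplex_lebesgue. ?w p"
  have G0: "0 \<le> G" using G[OF m] by linarith
  have pt: "\<bar>g p - g m\<bar> \<le> \<epsilon> + 2 * G / r\<^sup>2 * (norm (p - m))\<^sup>2" if p: "p \<in> int_simplex" for p
  proof (cases "norm (p - m) < r")
    case True
    then show ?thesis using uc[OF p m] G0 by (intro order_trans[OF uc[OF p m]]) auto
  next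
    case False
    then have "1 \<le> (norm (p - m))\<^sup>2 / r\<^sup>2"
      using r by (simp add: power_mono)
    then have "2 * G * 1 \<le> 2 * G * ((norm (p - m))\<^sup>2 / r\<^sup>2)"
      using G0 by (intro mult_left_mono) auto
    moreover have "\<bar>g p - g m\<bar> \<le> 2 * G" using G[OF p] G[OF m] by linarith
    ultimately show ?thesis using \<epsilon> by simp
  qed
  have ig: "integrable simplex_lebesgue (\<lambda>p. g p * ?w p)"
  proof (rule Bochner_Integration.integrable_bound)
    show "integrable simplex_lebesgue (\<lambda>p. G * ?w p)" using int by simp
    show "AE p in simplex_lebesgue. norm (g p * ?w p) \<le> norm (G * ?w p)"
      using AE_simplex_pos[OF K]
      by eventually_elim (use G G0 in \<open>auto simp: abs_mult intro!: mult_right_mono\<close>)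
  qed measurable
  note i2 = dirichlet_second_moment[OF b int, where m = m]
  have "(LINT p|simplex_lebesgue. g p * ?w p) - g m * ?D = (LINT p|simplex_lebesgue. (g p - g m) * ?w p)"
    using ig int by (simp add: left_diff_distrib)
  also have "\<bar>\<dots>\<bar> \<le> (LINT p|simplex_lebesgue. \<bar>(g p - g m) * ?w p\<bar>)"
    by (rule integral_abs_bound)
  also have "\<dots> \<le> (LINT p|simplex_lebesgue. \<epsilon> * ?w p + 2 * G / r\<^sup>2 * ((norm (p - m))\<^sup>2 * ?w p))"
  proof (rule integral_mono_AE)
    show "integrable simplex_lebesgue (\<lambda>p. \<bar>(g p - g m) * ?w p\<bar>)"
      using ig int by (auto simp: left_diff_distrib)
    show "integrable simplex_lebesgue (\<lambda>p. \<epsilon> * ?w p + 2 * G / r\<^sup>2 * ((norm (p - m))\<^sup>2 * ?w p))"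
      using int i2(1) by (intro Bochner_Integration.integrable_add integrable_mult_right)
    show "AE p in simplex_lebesgue. \<bar>(g p - g m) * ?w p\<bar> \<le> \<epsilon> * ?w p + 2 * G / r\<^sup>2 * ((norm (p - m))\<^sup>2 * ?w p)"
      using AE_simplex_pos[OF K]
    proof eventually_elim
      case (elim p)
      show ?case
        using mult_right_mono[OF pt[OF elim], of "?w p"]
        by (simp only: abs_mult abs_of_nonneg[OF dirichlet_kernel_nonneg] dirichlet_kernel_nonneg distrib_right mult.assoc)
    qed
  qed
  also have "\<dots> = \<epsilon> * ?D + 2 * G / r\<^sup>2 * (LINT p|simplex_lebesgue. (norm (p - m))\<^sup>2 * ?w p)"
    using int i2(1) by (subst Bochner_Integration.integral_add) auto
  also have "\<dots> \<le> \<epsilon> * ?D + 2 * G / r\<^sup>2 * ((1 / B + (norm (b /\<^sub>R B - m))\<^sup>2) * ?D)"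
    using i2(2) G0 unfolding B_def by (intro add_left_mono mult_left_mono) auto
  finally show ?thesis by (simp add: distrib_right mult.assoc)
qed


section \<open>Posterior means\<close>

text \<open>If numerator and denominator have relative error at most \<open>\<mu>\<close> and
  \<open>\<mu> \<le> 1/3\<close>, then the quotient has relative error at most
  \<open>3 * \<mu>\<close>. The common factor \<open>g\<close> cancels.\<close>

lemma bayes_ratio_bounds:
  fixes X0 X1 D0 r g \<mu> \<kappa> :: real
  assumes D0: "0 < D0" and r: "0 \<le> r" and g: "0 < g" and \<mu>: "0 \<le> \<mu>" "\<mu> = \<kappa> / 3" "\<kappa> < 1"
    and X0: "\<bar>X0 - g * D0\<bar> \<le> \<mu> * g * D0" and X1: "\<bar>X1 - g * (r * D0)\<bar> \<le> \<mu> * g * (r * D0)"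
  shows "\<bar>X1 / X0 - r\<bar> \<le> \<kappa> * r"
proof -
  have \<kappa>: "0 \<le> \<kappa>" "\<kappa> * \<kappa> \<le> \<kappa>" using \<mu> mult_left_le[of \<kappa> \<kappa>] by auto
  define t where "t = g * D0"
  have t: "0 < t" using g D0 by (simp add: t_def)
  have X0': "(1 - \<mu>) * t \<le> X0" "X0 \<le> (1 + \<mu>) * t"
    using X0 by (auto simp: t_def abs_le_iff algebra_simps)
  have X1': "(1 - \<mu>) * r * t \<le> X1" "X1 \<le> (1 + \<mu>) * r * t"
    using X1 by (auto simp: t_def abs_le_iff algebra_simps)
  have pos: "0 < X0"
    using X0'(1) \<mu> t by (intro less_le_trans[OF mult_pos_pos X0'(1)]) auto
  have rt: "0 \<le> r * t" using r t by simp
  have "(1 + \<mu>) \<le> (1 + \<kappa>) * (1 - \<mu>)" "(1 - \<kappa>) * (1 + \<mu>) \<le> 1 - \<mu>"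
    using \<kappa> unfolding \<mu>(2) by (auto simp: algebra_simps add_divide_distrib)
  then have "(1 + \<mu>) * (r * t) \<le> (1 + \<kappa>) * (1 - \<mu>) * (r * t)"
    "(1 - \<kappa>) * (1 + \<mu>) * (r * t) \<le> (1 - \<mu>) * (r * t)"
    using rt by (auto intro: mult_right_mono)
  moreover have "(1 + \<kappa>) * r * ((1 - \<mu>) * t) \<le> (1 + \<kappa>) * r * X0"
    using X0' \<kappa> r by (intro mult_left_mono) auto
  moreover have "(1 - \<kappa>) * r * X0 \<le> (1 - \<kappa>) * r * ((1 + \<mu>) * t)"
    using X0' \<mu> r by (intro mult_left_mono) auto
  ultimately have "X1 \<le> (1 + \<kappa>) * r * X0" "(1 - \<kappa>) * r * X0 \<le> X1"
    using X1' by (auto simp: algebra_simps)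
  then show ?thesis
    using pos by (simp add: abs_le_iff field_simps)
qed

text \<open>Conjugacy: the likelihood of the counts \<open>y\<close> turns a Dirichlet kernel into
  another one, with the counts added to the parameters.\<close>

lemma dirichlet_kernel_shift:
  assumes "p \<in> int_simplex"
  shows "dirichlet_kernel (\<alpha> + (\<chi> i. real (y i))) p = (\<Prod>i\<in>UNIV. p $ i ^ y i) * dirichlet_kernel \<alpha> p"
proof -
  have "p $ i powr ((\<alpha> + (\<chi> i. real (y i))) $ i - 1) = p $ i ^ y i * p $ i powr (\<alpha> $ i - 1)" for i
  proof -
    have "0 < p $ i" using assms by (simp add: int_simplex_def)
    then show ?thesis
      by (simp add: powr_add powr_diff powr_realpow)
  qed
  then show ?thesis
    by (simp add: dirichlet_kernel_def prod.distrib)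
qed

lemma int_simplex_bounded: "bounded (int_simplex :: (real ^ 'k::finite) set)"
proof (rule bounded_subset)
  show "int_simplex \<subseteq> cball (0 :: real ^ 'k) (real CARD('k))"
  proof
    fix p :: "real ^ 'k" assume "p \<in> int_simplex"
    then have "(\<Sum>i\<in>UNIV. \<bar>p $ i\<bar>) \<le> (\<Sum>i\<in>(UNIV::'k set). 1)"
      by (intro sum_mono) (auto simp: int_simplex_def prob_simplex_def)
    then show "p \<in> cball 0 (real CARD('k))"
      using norm_le_l1_cart[of p] by simp
  qed
qed auto

text \<open>A zero integral would force \<open>w = 0\<close> almost everywhere, although the simplex
  has positive mass.\<close>

lemma integral_simplex_pos:
  fixes w :: "real ^ 'k::finite \<Rightarrow> real"
  assumes K: "CARD('k) \<ge> 2" and w: "integrable simplex_lebesgue w"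
    and pos: "\<And>p. p \<in> int_simplex \<Longrightarrow> 0 < w p"
  shows "0 < (LINT p|simplex_lebesgue. w p)"
proof -
  have nn: "AE p in simplex_lebesgue. 0 \<le> w p"
    using AE_simplex_pos[OF K] by eventually_elim (simp add: pos less_imp_le)
  have "(LINT p|simplex_lebesgue. w p) \<noteq> 0"
  proof
    assume "(LINT p|simplex_lebesgue. w p) = 0"
    then have "AE p in simplex_lebesgue. w p = 0"
      using integral_nonneg_eq_0_iff_AE[OF w nn] by simp
    then have "AE p in (simplex_lebesgue :: (real ^ 'k) measure). False"
      using AE_simplex_pos[OF K] by eventually_elim (use pos in force)
    then have "emeasure (simplex_lebesgue :: (real ^ 'k) measure) (space simplex_lebesgue) = 0"
      by (simp add: AE_iff_null null_sets_def)
    then show False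
      by (simp add: space_simplex_lebesgue emeasure_simplex_lebesgue)
  qed
  then show ?thesis using integral_nonneg_AE[OF nn] by simp
qed

text \<open>The estimator as a function of the counts alone, so that uniformity over all
  \<open>y\<close> can be stated without reference to tosses.\<close>

definition posterior_mean :: "(real ^ 'k::finite \<Rightarrow> real) \<Rightarrow> ('k \<Rightarrow> nat) \<Rightarrow> 'k \<Rightarrow> real" where
  "posterior_mean f y k =
     (LINT p|simplex_lebesgue. p $ k * (\<Prod>i\<in>UNIV. p $ i ^ y i) * f p) /
     (LINT p|simplex_lebesgue. (\<Prod>i\<in>UNIV. p $ i ^ y i) * f p)"

text \<open>The posterior mean is a quotient of integrals of \<open>g\<close> against two kernels,
  with parameters \<open>a\<close> and \<open>a + axis k 1\<close>. Both are compared with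
  \<open>g m\<close> at the same point \<open>m\<close>, and the quotient of the kernel masses is
  \<open>a $ k / A\<close>. Since the factor \<open>p $ k\<close> is absorbed into the second
  kernel, the error is relative rather than absolute.\<close>

lemma posterior_mean_approx:
  fixes f :: "real ^ 'k::finite \<Rightarrow> real" and \<alpha> :: "real ^ 'k"
  assumes K: "CARD('k) \<ge> 2" and f: "density_on_simplex f"
    and \<alpha>: "\<And>k. 0 < \<alpha> $ k" and P: "condition_P_at \<alpha> f"
    and \<kappa>: "0 < \<kappa>" "\<kappa> < 1"
  shows "\<exists>N::nat. \<forall>y k. N \<le> (\<Sum>i\<in>UNIV. y i) \<longrightarrow>
    \<bar>posterior_mean f y k - (\<alpha> $ k + y k) / (\<Sum>i\<in>UNIV. \<alpha> $ i + y i)\<bar>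
      \<le> \<kappa> * ((\<alpha> $ k + y k) / (\<Sum>i\<in>UNIV. \<alpha> $ i + y i))"
proof -
  let ?M = "simplex_lebesgue :: (real ^ 'k) measure"
  define g where "g p = f p / dirichlet_kernel \<alpha> p" for p
  have fm [measurable]: "f \<in> borel_measurable ?M" and f0: "\<And>p. p \<in> prob_simplex \<Longrightarrow> 0 \<le> f p"
    and f1: "(\<integral>\<^sup>+p. ennreal (f p) \<partial>?M) = 1"
    using f by (auto simp: density_on_simplex_def)
  have gm [measurable]: "g \<in> borel_measurable ?M"
    unfolding g_def[abs_def] by measurable
  have geq: "f p = g p * dirichlet_kernel \<alpha> p" if "p \<in> int_simplex" for p
    using dirichlet_kernel_pos[OF that, of \<alpha>] by (simp add: g_def)
  from P obtain l where l: "0 < l" "\<And>p. p \<in> int_simplex \<Longrightarrow> l \<le> g p"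
    and uc: "uniformly_continuous_on int_simplex g"
    unfolding condition_P_at_def g_def[abs_def] dirichlet_kernel_def by auto
  \<comment> \<open>A uniformly continuous function on a bounded set is bounded.\<close>
  obtain G where G: "\<And>p. p \<in> int_simplex \<Longrightarrow> \<bar>g p\<bar> \<le> G"
    using bounded_uniformly_continuous_image[OF uc int_simplex_bounded]
    unfolding bounded_iff by auto
  define \<mu> where "\<mu> = \<kappa> / 3"
  have \<mu>: "0 < \<mu>" using \<kappa> by (simp add: \<mu>_def)
  \<comment> \<open>The error allowed is \<open>\<mu> * g m\<close>, which is at least
    \<open>\<mu> * l\<close>. One half goes to the oscillation of \<open>g\<close>, the other to the
    Chebyshev term.\<close>
  obtain r where r: "0 < r"
    "\<And>p p'. p \<in> int_simplex \<Longrightarrow> p' \<in> int_simplex \<Longrightarrow> norm (p - p') < r \<Longrightarrow> \<bar>g p - g p'\<bar> \<le> \<mu> * l / 2"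
  proof -
    have "0 < \<mu> * l / 2" using \<mu> l by simp
    then obtain r where "0 < r" "\<forall>p\<in>int_simplex. \<forall>p'\<in>int_simplex. dist p' p < r \<longrightarrow> dist (g p') (g p) < \<mu> * l / 2"
      using uc unfolding uniformly_continuous_on_def by blast
    then show ?thesis
      by (intro that[of r]) (auto simp: dist_norm intro!: less_imp_le)
  qed
  define H where "H = 2 * G / r\<^sup>2"
  have fi: "integrable ?M f"
    using f1 f0 by (intro integrableI_nonneg) (auto simp: space_simplex_lebesgue intro!: AE_I2)
  \<comment> \<open>Because \<open>g\<close> is at least \<open>l\<close>, the kernel is dominated
    by \<open>f / l\<close>, and \<open>f\<close> is a density.\<close>
  have wi: "integrable ?M (dirichlet_kernel \<alpha>)"
  proof (rule Bochner_Integration.integrable_bound)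
    show "integrable ?M (\<lambda>p. inverse l * f p)" using fi by simp
    show "AE p in ?M. norm (dirichlet_kernel \<alpha> p) \<le> norm (inverse l * f p)"
      using AE_simplex_pos[OF K]
    proof eventually_elim
      case (elim p)
      have "l * dirichlet_kernel \<alpha> p \<le> f p"
        using geq[OF elim] l(2)[OF elim] by (simp add: mult_right_mono)
      moreover have "0 \<le> f p" using elim f0 by (simp add: int_simplex_def)
      ultimately show ?case using l(1) by (simp add: field_simps)
    qed
  qed measurable
  \<comment> \<open>Makes \<open>H * (5 / A)\<close> at most \<open>\<mu> * l / 2\<close> as soon as
    \<open>A\<close> is at least \<open>N\<close>; the 5 comes from \<open>e'\<close> below.\<close>
  obtain N :: nat where N: "max 1 (5 * H / (\<mu> * l / 2)) \<le> real N"
    using real_arch_simple by blast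
  show ?thesis
  proof (intro exI[of _ N] allI impI)
    fix y :: "'k \<Rightarrow> nat" and k :: 'k
    assume y: "N \<le> (\<Sum>i\<in>UNIV. y i)"
    define a where "a = \<alpha> + (\<chi> i. real (y i))"
    define A where "A = (\<Sum>i\<in>UNIV. a $ i)"
    have a: "0 < a $ i" for i using \<alpha>[of i] by (simp add: a_def add_pos_nonneg)
    have "real N \<le> (\<Sum>i\<in>UNIV. real (y i))" using y by (simp flip: of_nat_sum)
    also have "\<dots> \<le> A" unfolding A_def a_def using \<alpha> by (intro sum_mono) (simp add: less_imp_le)
    finally have NA: "real N \<le> A" .
    have A: "1 \<le> A" using N NA by auto
    \<comment> \<open>The mean of the Dirichlet distribution with parameter \<open>a\<close>; it is
      interior even when some counts are zero, because \<alpha> is positive.\<close>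
    define m where "m = a /\<^sub>R A"
    have m: "m \<in> int_simplex"
    proof -
      have "(\<Sum>i\<in>UNIV. m $ i) = 1"
        using A by (simp add: m_def A_def flip: sum_distrib_left)
      moreover have "0 < m $ i" for i using a[of i] A by (simp add: m_def)
      ultimately show ?thesis by (simp add: int_simplex_def prob_simplex_iff less_imp_le)
    qed
    have ai: "integrable ?M (dirichlet_kernel a)"
    proof (rule Bochner_Integration.integrable_bound[OF wi])
      show "AE p in ?M. norm (dirichlet_kernel a p) \<le> norm (dirichlet_kernel \<alpha> p)"
        using AE_simplex_pos[OF K]
      proof eventually_elim
        case (elim p)
        have "(\<Prod>i\<in>UNIV. p $ i ^ y i) \<le> 1" "0 \<le> (\<Prod>i\<in>UNIV. p $ i ^ y i)"
          using elim by (auto simp: int_simplex_def prob_simplex_def intro!: prod_le_1 prod_nonneg power_le_one)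
        then show ?case
          unfolding a_def dirichlet_kernel_shift[OF elim] by (simp add: abs_mult mult_left_le_one_le)
      qed
    qed measurable
    let ?D = "LINT p|?M. dirichlet_kernel a p"
    have D: "0 < ?D"
      by (intro integral_simplex_pos K ai dirichlet_kernel_pos)
    have lm: "l \<le> g m" by (rule l(2)[OF m])
    have G0: "0 \<le> H" using G[OF m] by (simp add: H_def)
    \<comment> \<open>Used for \<open>b = a\<close>, where the bias is zero, and for
      \<open>b = a + axis k 1\<close>.\<close>
    have bound: "\<bar>(LINT p|?M. g p * dirichlet_kernel b p) - g m * (LINT p|?M. dirichlet_kernel b p)\<bar>
        \<le> \<mu> * g m * (LINT p|?M. dirichlet_kernel b p)"
      if b: "\<And>i. 0 < b $ i" and bi: "integrable ?M (dirichlet_kernel b)"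
        and e: "1 / (\<Sum>i\<in>UNIV. b $ i) + (norm (b /\<^sub>R (\<Sum>i\<in>UNIV. b $ i) - m))\<^sup>2 \<le> 5 / A" for b
    proof (rule order_trans[OF dirichlet_integral_approx[OF K b bi gm G _ r m] mult_right_mono])
      show "0 \<le> \<mu> * l / 2" using \<mu> l(1) by simp
      have "H * (1 / (\<Sum>i\<in>UNIV. b $ i) + (norm (b /\<^sub>R (\<Sum>i\<in>UNIV. b $ i) - m))\<^sup>2) \<le> H * (5 / A)"
        by (rule mult_left_mono[OF e G0])
      also have "\<dots> \<le> \<mu> * l / 2"
      proof -
        have "5 * H / (\<mu> * l / 2) \<le> A" using N NA by linarith
        then show ?thesis using A \<mu> l(1) by (simp add: field_simps)
      qed
      finally have "\<mu> * l / 2 + H * (1 / (\<Sum>i\<in>UNIV. b $ i) + (norm (b /\<^sub>R (\<Sum>i\<in>UNIV. b $ i) - m))\<^sup>2) \<le> \<mu> * l"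
        by linarith
      also have "\<dots> \<le> \<mu> * g m" using \<mu> lm by simp
      finally show "\<mu> * l / 2 + 2 * G / r\<^sup>2 * (1 / (\<Sum>i\<in>UNIV. b $ i) + (norm (b /\<^sub>R (\<Sum>i\<in>UNIV. b $ i) - m))\<^sup>2) \<le> \<mu> * g m"
        unfolding H_def .
    qed (auto intro!: Bochner_Integration.integral_nonneg)
    let ?a' = "a + axis k 1"
    have sum': "(\<Sum>i\<in>UNIV. ?a' $ i) = A + 1"
      by (simp add: A_def sum.distrib axis_def)
    \<comment> \<open>Adding one to parameter \<open>k\<close> moves the mean from \<open>m\<close>
      by \<open>(axis k 1 - m) /\<^sub>R (A + 1)\<close>, of norm at most
      \<open>2 / (A + 1)\<close>. The variance contributes 1 and the squared bias at most 4 to the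
      constant 5.\<close>
    have e': "1 / (A + 1) + (norm (?a' /\<^sub>R (A + 1) - m))\<^sup>2 \<le> 5 / A"
    proof -
      have "?a' /\<^sub>R (A + 1) - m = (axis k 1 - m) /\<^sub>R (A + 1)"
      proof -
        have aA: "a = A *\<^sub>R m" using A by (simp add: m_def)
        have "A + 1 \<noteq> 0" using A by simp
        then have "(A * m $ i + axis k 1 $ i) / (A + 1) - m $ i = (axis k 1 $ i - m $ i) / (A + 1)" for i
          by (simp add: field_simps)
        then show ?thesis
          by (subst aA) (simp add: vec_eq_iff divide_inverse mult.commute)
      qed
      moreover have "norm (axis k 1 - m) \<le> 2"
      proof -
        have "norm m \<le> (\<Sum>i\<in>UNIV. \<bar>m $ i\<bar>)" by (rule norm_le_l1_cart)
        also have "\<dots> = 1" using m by (simp add: int_simplex_def prob_simplex_def)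
        finally show ?thesis
          using norm_triangle_ineq4[of "axis k 1" m] by (simp add: norm_axis_1)
      qed
      ultimately have "norm (?a' /\<^sub>R (A + 1) - m) \<le> 2 / (A + 1)"
        using A by (simp add: divide_inverse mult.commute mult_left_mono)
      then have "(norm (?a' /\<^sub>R (A + 1) - m))\<^sup>2 \<le> (2 / (A + 1))\<^sup>2"
        by (intro power_mono) auto
      also have "\<dots> \<le> 4 / (A + 1)"
        using A mult_left_le[of "1 / (A + 1)" "4 / (A + 1)"] by (simp add: power2_eq_square)
      finally have "1 / (A + 1) + (norm (?a' /\<^sub>R (A + 1) - m))\<^sup>2 \<le> 5 / (A + 1)"
        by (simp add: field_simps)
      also have "\<dots> \<le> 5 / A" using A by (simp add: frac_le)
      finally show ?thesis .
    qed
    have a': "0 < ?a' $ i" for i using a[of i] by (auto simp: axis_def add_pos_nonneg)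
    have D': "(LINT p|?M. dirichlet_kernel ?a' p) = a $ k / A * ?D"
      unfolding A_def by (rule integral_dirichlet_kernel_axis[OF a ai])
    have "\<bar>(LINT p|?M. g p * dirichlet_kernel ?a' p) / (LINT p|?M. g p * dirichlet_kernel a p) - a $ k / A\<bar>
        \<le> \<kappa> * (a $ k / A)"
    proof (rule bayes_ratio_bounds[OF D])
      show "0 \<le> a $ k / A" using a[of k] A by simp
      show "0 < g m" using lm l(1) by simp
      show "\<bar>(LINT p|?M. g p * dirichlet_kernel a p) - g m * ?D\<bar> \<le> \<mu> * g m * ?D"
        using A by (intro bound a ai) (simp add: A_def[symmetric] m_def divide_right_mono)
      show "\<bar>(LINT p|?M. g p * dirichlet_kernel ?a' p) - g m * (a $ k / A * ?D)\<bar> \<le> \<mu> * g m * (a $ k / A * ?D)"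
        unfolding D'[symmetric]
        by (intro bound a' integrable_dirichlet_kernel_axis ai) (unfold sum', rule e')
    qed (use \<mu> \<kappa> \<mu>_def in auto)
    moreover have "(LINT p|?M. (\<Prod>i\<in>UNIV. p $ i ^ y i) * f p) = (LINT p|?M. g p * dirichlet_kernel a p)"
    proof (intro integral_cong_AE)
      show "AE p in ?M. (\<Prod>i\<in>UNIV. p $ i ^ y i) * f p = g p * dirichlet_kernel a p"
        using AE_simplex_pos[OF K]
        by eventually_elim (simp add: a_def dirichlet_kernel_shift geq)
    qed measurable
    moreover have "(LINT p|?M. p $ k * (\<Prod>i\<in>UNIV. p $ i ^ y i) * f p) = (LINT p|?M. g p * dirichlet_kernel ?a' p)"
    proof (intro integral_cong_AE)
      show "AE p in ?M. p $ k * (\<Prod>i\<in>UNIV. p $ i ^ y i) * f p = g p * dirichlet_kernel ?a' p"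
        using AE_simplex_pos[OF K]
      proof eventually_elim
        case (elim p)
        have "0 \<le> p $ k" using elim by (simp add: int_simplex_def prob_simplex_def)
        then show ?case
          using elim by (simp add: dirichlet_kernel_axis a_def dirichlet_kernel_shift geq)
      qed
    qed measurable
    moreover have "A = (\<Sum>i\<in>UNIV. \<alpha> $ i + y i)" by (simp add: A_def a_def)
    ultimately show "\<bar>posterior_mean f y k - (\<alpha> $ k + y k) / (\<Sum>i\<in>UNIV. \<alpha> $ i + y i)\<bar>
      \<le> \<kappa> * ((\<alpha> $ k + y k) / (\<Sum>i\<in>UNIV. \<alpha> $ i + y i))"
      by (simp add: posterior_mean_def a_def)
  qed
qed

lemma bayes_estimator_eq_posterior_mean:
  "bayes_estimator f c x k = posterior_mean f (\<lambda>i. count_list x (c, i)) k"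
  by (simp add: bayes_estimator_def posterior_mean_def)

text \<open>Separates the two inequalities, the lower one for the blue die and the upper one for the
  red die, and makes the denominator depend only on the number \<open>n\<close> of tosses.\<close>

lemma condition_P_posterior_mean:
  fixes f :: "real ^ 'k::finite \<Rightarrow> real"
  assumes K: "CARD('k) \<ge> 2" and f: "density_on_simplex f" and P: "condition_P f"
    and \<kappa>: "0 < \<kappa>" "\<kappa> < 1"
  obtains \<alpha> :: "real ^ 'k" and N :: nat where "\<And>k. 0 < \<alpha> $ k"
    and "\<And>y n k. N \<le> n \<Longrightarrow> (\<Sum>i\<in>UNIV. y i) = n \<Longrightarrow>
      (1 - \<kappa>) * ((\<alpha> $ k + real (y k)) / ((\<Sum>i\<in>UNIV. \<alpha> $ i) + n)) \<le> posterior_mean f y k"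
    and "\<And>y n k. N \<le> n \<Longrightarrow> (\<Sum>i\<in>UNIV. y i) = n \<Longrightarrow>
      posterior_mean f y k \<le> (1 + \<kappa>) * ((\<alpha> $ k + real (y k)) / ((\<Sum>i\<in>UNIV. \<alpha> $ i) + n))"
proof -
  from P obtain \<alpha> :: "real ^ 'k" where \<alpha>: "\<And>k. 0 < \<alpha> $ k" and Pa: "condition_P_at \<alpha> f"
    by (auto simp: condition_P_def)
  obtain N where N: "\<And>y k. N \<le> (\<Sum>i\<in>UNIV. y i) \<Longrightarrow>
    \<bar>posterior_mean f y k - (\<alpha> $ k + y k) / (\<Sum>i\<in>UNIV. \<alpha> $ i + y i)\<bar>
      \<le> \<kappa> * ((\<alpha> $ k + y k) / (\<Sum>i\<in>UNIV. \<alpha> $ i + y i))"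
    using posterior_mean_approx[OF K f \<alpha> Pa \<kappa>] by blast
  have approx: "\<bar>posterior_mean f y k - (\<alpha> $ k + y k) / ((\<Sum>i\<in>UNIV. \<alpha> $ i) + n)\<bar>
      \<le> \<kappa> * ((\<alpha> $ k + y k) / ((\<Sum>i\<in>UNIV. \<alpha> $ i) + n))" if "N \<le> n" "(\<Sum>i\<in>UNIV. y i) = n" for y n k
    using N[of y k] that by (auto simp: sum.distrib simp flip: of_nat_sum)
  have split: "(1 - \<kappa>) * u \<le> v" "v \<le> (1 + \<kappa>) * u" if "\<bar>v - u\<bar> \<le> \<kappa> * u" for u v
    using that by (auto simp: abs_le_iff algebra_simps)
  show thesis
    by (rule that[of \<alpha> N], rule \<alpha>) (erule (1) split[OF approx])+
qed


section \<open>Counts of tosses\<close>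

text \<open>The count is a sum of indicators, and its square is a double sum of products whose
  expectations follow from independence. The common probability \<open>x\<close> is asked for on
  \<open>T\<close> only, since the tosses of the other die have a different law.\<close>

lemma count_moments:
  fixes P :: "'i \<Rightarrow> 'a pmf" and x :: real
  assumes T: "finite T" "T \<subseteq> I" and pmf_P: "\<And>t. t \<in> T \<Longrightarrow> pmf (P t) k = x"
  defines "M \<equiv> Pi\<^sub>M I (\<lambda>t. measure_pmf (P t))"
  defines "S \<equiv> \<lambda>\<omega>. real (card {t\<in>T. \<omega> t = k})"
  shows "S \<in> borel_measurable M"
    and "integrable M S" and "integrable M (\<lambda>\<omega>. (S \<omega>)\<^sup>2)"
    and "integral\<^sup>L M S = card T * x"
    and "(LINT \<omega>|M. (S \<omega>)\<^sup>2) = (card T * x)\<^sup>2 + card T * (x - x\<^sup>2)"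
proof -
  interpret product_prob_space "\<lambda>t. measure_pmf (P t)" I
    by (intro product_prob_spaceI measure_pmf.prob_space_axioms)
  interpret PM: prob_space M
    unfolding M_def by (intro prob_space_PiM measure_pmf.prob_space_axioms)
  define X where "X t \<omega> = (indicator {\<omega>\<in>space M. \<omega> t = k} \<omega> :: real)" for t \<omega>
  have ev: "{\<omega>\<in>space M. \<omega> t = k} \<in> sets M" if "t \<in> T" for t
  proof -
    have "(\<lambda>\<omega>. \<omega> t) \<in> M \<rightarrow>\<^sub>M measure_pmf (P t)"
      unfolding M_def using T that by (intro measurable_component_singleton) auto
    from measurable_sets[OF this, of "{k}"] show ?thesis
      by (simp add: vimage_def Int_def conj_commute)
  qed
  have prob: "measure M {\<omega>\<in>space M. \<forall>t\<in>J. \<omega> t = k} = x ^ card J" if "J \<subseteq> T" for J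
  proof -
    have fin: "finite J" using that T finite_subset by blast
    have x0: "0 \<le> x" if "t \<in> T" for t using pmf_P[OF that] pmf_nonneg[of "P t" k] by simp
    have "emeasure M {\<omega>\<in>space M. \<forall>t\<in>J. \<omega> t \<in> {k}} = (\<Prod>t\<in>J. emeasure (measure_pmf (P t)) {k})"
      unfolding M_def using that T fin by (intro emeasure_PiM_Collect) auto
    also have "\<dots> = (\<Prod>t\<in>J. ennreal x)"
      using that pmf_P by (intro prod.cong) (auto simp: emeasure_pmf_single)
    finally have "emeasure M {\<omega>\<in>space M. \<forall>t\<in>J. \<omega> t = k} = ennreal x ^ card J" by simp
    then show ?thesis
      using x0 that by (cases "J = {}") (auto simp: measure_def ennreal_power)
  qed
  have S: "S \<omega> = (\<Sum>t\<in>T. X t \<omega>)" if "\<omega> \<in> space M" for \<omega>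
    using that T by (simp add: S_def X_def indicator_def sum.If_cases Int_def conj_commute)
  have XX: "X s \<omega> * X t \<omega> = indicator {\<omega>\<in>space M. \<forall>u\<in>{s, t}. \<omega> u = k} \<omega>" for s t \<omega>
    by (auto simp: X_def indicator_def)
  have Xm [measurable]: "X t \<in> borel_measurable M" if "t \<in> T" for t
    unfolding X_def[abs_def] using ev[OF that] by measurable
  have iX: "integrable M (X t)" if "t \<in> T" for t
    unfolding X_def[abs_def] using ev[OF that] by (simp add: PM.emeasure_eq_measure)
  have iXX: "integrable M (\<lambda>\<omega>. X s \<omega> * X t \<omega>)" if "s \<in> T" "t \<in> T" for s t
  proof (rule PM.integrable_const_bound[where B = 1])
    show "(\<lambda>\<omega>. X s \<omega> * X t \<omega>) \<in> borel_measurable M"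
      using that by (intro borel_measurable_times Xm)
  qed (auto simp: X_def indicator_def)
  have EX: "integral\<^sup>L M (X t) = x" if "t \<in> T" for t
    unfolding X_def[abs_def] using ev[OF that] prob[of "{t}"] that by simp
  \<comment> \<open>For \<open>s = t\<close> the set \<open>{s, t}\<close> is a singleton, so
    \<open>prob\<close> gives \<open>x\<close> in place of the square.\<close>
  have EXX: "(LINT \<omega>|M. X s \<omega> * X t \<omega>) = (if s = t then x else x\<^sup>2)" if "s \<in> T" "t \<in> T" for s t
  proof -
    have "{\<omega>\<in>space M. \<omega> s = k \<and> \<omega> t = k} = {\<omega>\<in>space M. \<omega> s = k} \<inter> {\<omega>\<in>space M. \<omega> t = k}"
      by auto
    then have "{\<omega>\<in>space M. \<omega> s = k \<and> \<omega> t = k} \<in> sets M"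
      using ev that by auto
    then show ?thesis
      unfolding XX using prob[of "{s, t}"] that by (auto simp: power2_eq_square)
  qed
  have S2: "(S \<omega>)\<^sup>2 = (\<Sum>s\<in>T. \<Sum>t\<in>T. X s \<omega> * X t \<omega>)" if "\<omega> \<in> space M" for \<omega>
    unfolding S[OF that] power2_eq_square by (rule sum_product)
  show "S \<in> borel_measurable M"
    by (subst measurable_cong[OF S]) (auto intro!: borel_measurable_sum Xm)
  show "integrable M S"
    by (subst Bochner_Integration.integrable_cong[OF refl S]) (auto intro: iX)
  show "integrable M (\<lambda>\<omega>. (S \<omega>)\<^sup>2)"
    by (subst Bochner_Integration.integrable_cong[OF refl S2]) (auto intro!: iXX Bochner_Integration.integrable_sum)
  show "integral\<^sup>L M S = card T * x"
    by (subst Bochner_Integration.integral_cong[OF refl S]) (auto simp: iX EX Bochner_Integration.integral_sum)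
  have "(LINT \<omega>|M. (S \<omega>)\<^sup>2) = (LINT \<omega>|M. (\<Sum>s\<in>T. \<Sum>t\<in>T. X s \<omega> * X t \<omega>))"
    by (intro Bochner_Integration.integral_cong refl S2)
  also have "\<dots> = (\<Sum>s\<in>T. LINT \<omega>|M. (\<Sum>t\<in>T. X s \<omega> * X t \<omega>))"
    by (rule Bochner_Integration.integral_sum, rule Bochner_Integration.integrable_sum, rule iXX)
  also have "\<dots> = (\<Sum>s\<in>T. \<Sum>t\<in>T. LINT \<omega>|M. X s \<omega> * X t \<omega>)"
    by (rule sum.cong[OF refl], rule Bochner_Integration.integral_sum, rule iXX)
  also have "\<dots> = (\<Sum>s\<in>T. \<Sum>t\<in>T. if s = t then x else x\<^sup>2)"
    by (rule sum.cong[OF refl], rule sum.cong[OF refl], rule EXX)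
  also have "\<dots> = (\<Sum>s\<in>T. \<Sum>t\<in>T. x\<^sup>2 + (if s = t then x - x\<^sup>2 else 0))"
    by (intro sum.cong) auto
  also have "\<dots> = (card T * x)\<^sup>2 + card T * (x - x\<^sup>2)"
    using T(1) by (simp add: sum.distrib power2_eq_square algebra_simps)
  finally show "(LINT \<omega>|M. (S \<omega>)\<^sup>2) = (card T * x)\<^sup>2 + card T * (x - x\<^sup>2)" .
qed

text \<open>Keeping the factor \<open>x\<close> in the variance bound is essential: with deviations
  proportional to \<open>card T * x\<close> the probability is of order
  \<open>1 / (card T * x)\<close>, uniformly over rare sides.\<close>

lemma count_Chebyshev:
  fixes P :: "'i \<Rightarrow> 'a pmf" and x :: real
  assumes T: "finite T" "T \<subseteq> I" and pmf_P: "\<And>t. t \<in> T \<Longrightarrow> pmf (P t) k = x" and e: "0 < e"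
  defines "M \<equiv> Pi\<^sub>M I (\<lambda>t. measure_pmf (P t))"
  shows "measure M {\<omega>\<in>space M. e \<le> \<bar>real (card {t\<in>T. \<omega> t = k}) - card T * x\<bar>} \<le> card T * x / e\<^sup>2"
proof -
  interpret PM: prob_space M
    unfolding M_def by (intro prob_space_PiM measure_pmf.prob_space_axioms)
  note m = count_moments[where P = P, OF T pmf_P, folded M_def]
  have "measure M {\<omega>\<in>space M. e \<le> \<bar>real (card {t\<in>T. \<omega> t = k}) - card T * x\<bar>}
     \<le> PM.variance (\<lambda>\<omega>. real (card {t\<in>T. \<omega> t = k})) / e\<^sup>2"
    using PM.Chebyshev_inequality[OF m(1,3) e] by (simp only: m(4))
  also have "\<dots> = card T * (x - x\<^sup>2) / e\<^sup>2"
    using m by (subst PM.variance_eq) auto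
  also have "\<dots> \<le> card T * x / e\<^sup>2"
    by (intro divide_right_mono mult_left_mono) auto
  finally show ?thesis .
qed

section \<open>Counts read off from the observations\<close>

definition tosses :: "(nat \<Rightarrow> die) \<Rightarrow> nat \<Rightarrow> die \<Rightarrow> nat set" where
  "tosses d n c = {t\<in>{1..n}. d t = c}"

lemma count_observations:
  "count_list (observations d n \<omega>) (c, k) = card {t\<in>tosses d n c. \<omega> t = k}"
proof (induction n)
  case 0
  then show ?case by (simp add: observations_def tosses_def)
next
  case (Suc n)
  have fin: "finite {t\<in>tosses d n c. \<omega> t = k}" by (simp add: tosses_def)
  have "{t\<in>tosses d (Suc n) c. \<omega> t = k} =
     (if d (Suc n) = c \<and> \<omega> (Suc n) = k then insert (Suc n) {t\<in>tosses d n c. \<omega> t = k} else {t\<in>tosses d n c. \<omega> t = k})"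
    by (auto simp: tosses_def le_Suc_eq)
  moreover have "card (insert (Suc n) {t\<in>tosses d n c. \<omega> t = k}) = Suc (card {t\<in>tosses d n c. \<omega> t = k})"
    using fin by (intro card_insert_disjoint) (auto simp: tosses_def)
  moreover have "observations d (Suc n) \<omega> = observations d n \<omega> @ [(d (Suc n), \<omega> (Suc n))]"
    by (simp add: observations_def)
  ultimately show ?case
    using Suc by simp
qed

lemma sum_count_observations:
  fixes \<omega> :: "nat \<Rightarrow> 'k::finite"
  shows "(\<Sum>k\<in>UNIV. count_list (observations d n \<omega>) (c, k)) = card (tosses d n c)"
proof -
  have "card (tosses d n c) = card (\<Union>k. {t\<in>tosses d n c. \<omega> t = k})"
    by (intro arg_cong[where f = card]) auto
  also have "\<dots> = (\<Sum>k\<in>UNIV. card {t\<in>tosses d n c. \<omega> t = k})"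
    by (intro card_UN_disjoint) (auto simp: tosses_def)
  finally show ?thesis by (simp add: count_observations)
qed

lemma card_tosses_Red: "card (tosses d n Red) = n - card (tosses d n Blue)"
proof -
  have "tosses d n Red = {1..n} - tosses d n Blue"
  proof (rule set_eqI)
    fix t show "t \<in> tosses d n Red \<longleftrightarrow> t \<in> {1..n} - tosses d n Blue"
      by (cases "d t") (simp_all add: tosses_def)
  qed
  moreover have "tosses d n Blue \<subseteq> {1..n}" by (simp add: tosses_def subset_iff)
  ultimately show ?thesis
    using card_Diff_subset[of "tosses d n Blue" "{1..n}"] by (simp add: finite_subset[of "tosses d n Blue" "{1..n}"])
qed

text \<open>Lists over a countable type take countably many values, so in the induction step the
  tail can be held at each fixed value \<open>xs\<close>.\<close>

lemma measurable_map_component: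
  fixes P :: "'i \<Rightarrow> 'a::countable pmf"
  assumes "set ts \<subseteq> I"
  shows "(\<lambda>\<omega>. map \<omega> ts) \<in> Pi\<^sub>M I (\<lambda>t. measure_pmf (P t)) \<rightarrow>\<^sub>M count_space UNIV"
  using assms
proof (induction ts)
  case (Cons t ts)
  have "(\<lambda>\<omega>. \<omega> t) \<in> Pi\<^sub>M I (\<lambda>t. measure_pmf (P t)) \<rightarrow>\<^sub>M measure_pmf (P t)"
    using Cons.prems by (intro measurable_component_singleton) auto
  then have t: "(\<lambda>\<omega>. \<omega> t # xs) \<in> Pi\<^sub>M I (\<lambda>t. measure_pmf (P t)) \<rightarrow>\<^sub>M count_space UNIV" for xs
    by (rule measurable_compose) simp
  have "(\<lambda>\<omega>. \<omega> t # map \<omega> ts) \<in> Pi\<^sub>M I (\<lambda>t. measure_pmf (P t)) \<rightarrow>\<^sub>M count_space UNIV"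
    using Cons by (intro measurable_compose_countable[OF t]) auto
  then show ?case by simp
qed simp

text \<open>The colours are fixed and the sides form an element of a discrete space, so every
  property of the observations is an event, whatever estimators it involves.\<close>

lemma sets_observations:
  "{\<omega> \<in> space (toss_measure d p q). Q (observations d n \<omega>)} \<in> sets (toss_measure d p q)"
proof -
  let ?ts = "[1..<Suc n]"
  have "observations d n \<omega> = zip (map d ?ts) (map \<omega> ?ts)" for \<omega> :: "nat \<Rightarrow> 'a"
  proof -
    have "map (\<lambda>t. (d t, \<omega> t)) ts = zip (map d ts) (map \<omega> ts)" for ts
      by (induction ts) auto
    then show ?thesis by (simp only: observations_def)
  qed
  moreover have "(\<lambda>\<omega>. Q (zip (map d ?ts) (map \<omega> ?ts))) \<in> toss_measure d p q \<rightarrow>\<^sub>M count_space UNIV"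
    unfolding toss_measure_def
    by (rule measurable_compose[OF measurable_map_component]) auto
  ultimately show ?thesis
    by (simp add: pred_def)
qed

lemma toss_Chebyshev:
  fixes d :: "nat \<Rightarrow> die" and p q :: "real ^ 'k::finite" and x :: real and k :: 'k
  assumes pq: "(case c of Blue \<Rightarrow> p | Red \<Rightarrow> q) \<in> prob_simplex"
    and e: "0 < e"
  defines "M \<equiv> toss_measure d p q" and "x \<equiv> (case c of Blue \<Rightarrow> p | Red \<Rightarrow> q) $ k"
  shows "measure M {\<omega>\<in>space M. e \<le> \<bar>real (count_list (observations d n \<omega>) (c, k)) - card (tosses d n c) * x\<bar>}
     \<le> card (tosses d n c) * x / e\<^sup>2"
  unfolding M_def toss_measure_def count_observations
  by (intro count_Chebyshev e) (use pq in \<open>auto simp: tosses_def x_def pmf_side_pmf\<close>)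


section \<open>Comparison of the two dice\<close>

text \<open>The deterministic part. The deviation of \<open>Z\<close> is measured against
  \<open>r * p / c\<close> instead of \<open>r * q\<close>: the red probability may be far smaller
  than \<open>p / c\<close>, but only an upper bound by \<open>p / c\<close> is wanted. To first
  order the blue side loses \<open>3 * \<kappa>\<close> and the red side is charged
  \<open>5 * \<kappa>\<close>, whence \<open>\<kappa> = \<delta> / 8\<close>.\<close>

lemma blue_red_comparison:
  fixes \<kappa> \<delta> c b r p q Y Z phat qhat \<alpha>k A \<beta>k B :: real
  assumes \<delta>: "0 < \<delta>" "\<delta> < 1" "\<kappa> = \<delta> / 8" and c: "0 < c"
    and b: "0 < b" "A \<le> \<kappa> * b" "0 < A" "0 < \<alpha>k"
    and r: "0 < r" "0 < B" "\<beta>k * c \<le> \<kappa> * (r * p)"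
    and p: "0 < p" and q: "c * q \<le> p"
    and Y: "\<bar>Y - b * p\<bar> < \<kappa> * (b * p)"
    and Z: "\<bar>Z - r * q\<bar> < \<kappa> * (r * p / c)" "0 \<le> \<beta>k + Z"
    and phat: "(1 - \<kappa>) * ((\<alpha>k + Y) / (A + b)) \<le> phat"
    and qhat: "qhat \<le> (1 + \<kappa>) * ((\<beta>k + Z) / (B + r))"
  shows "c * (1 - \<delta>) * qhat \<le> phat"
proof -
  have \<kappa>: "0 < \<kappa>" "\<kappa> < 1" using \<delta> by auto
  \<comment> \<open>One factor pays for the deviation of \<open>Y\<close>, the other for the prior
    weight \<open>A\<close> in the denominator. The third factor, below, is the error of the
    posterior mean.\<close>
  have "(1 - \<kappa>)\<^sup>2 * p \<le> (\<alpha>k + Y) / (A + b)"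
  proof -
    have "(1 - \<kappa>) * p * ((1 - \<kappa>) * (A + b)) \<le> (1 - \<kappa>) * p * b"
    proof (intro mult_left_mono)
      have "(1 - \<kappa>) * A \<le> A" using \<kappa> b by (simp add: algebra_simps)
      then show "(1 - \<kappa>) * (A + b) \<le> b" using b by (simp add: algebra_simps)
    qed (use \<kappa> p in auto)
    also have "\<dots> \<le> \<alpha>k + Y" using Y b by (simp add: abs_less_iff algebra_simps)
    finally show ?thesis
      using b by (simp add: pos_le_divide_eq power2_eq_square mult_ac)
  qed
  then have "(1 - \<kappa>) * ((1 - \<kappa>)\<^sup>2 * p) \<le> phat"
    using \<kappa> by (intro order_trans[OF mult_left_mono phat]) auto
  then have phat': "(1 - \<kappa>) ^ 3 * p \<le> phat"
    by (simp add: power3_eq_cube power2_eq_square mult.assoc)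
  have "(\<beta>k + Z) / (B + r) \<le> (\<beta>k + Z) / r"
    using Z(2) r by (intro divide_left_mono) auto
  \<comment> \<open>One \<kappa> covers the prior weight \<open>\<beta>k\<close>, the other the
    deviation of \<open>Z\<close>.\<close>
  also have "\<dots> \<le> (1 + 2 * \<kappa>) * (p / c)"
  proof -
    have "\<beta>k \<le> \<kappa> * (r * p / c)" using r c by (simp add: field_simps)
    moreover have "r * q \<le> r * p / c" using q r c by (simp add: field_simps mult_left_mono)
    moreover have "Z < r * q + \<kappa> * (r * p / c)"
      using Z(1) by linarith
    moreover have "(1 + 2 * \<kappa>) * (r * p / c) = r * p / c + \<kappa> * (r * p / c) + \<kappa> * (r * p / c)"
      by (simp add: algebra_simps)
    ultimately have "\<beta>k + Z \<le> (1 + 2 * \<kappa>) * (r * p / c)"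
      by linarith
    then show ?thesis using r by (simp add: pos_divide_le_eq mult_ac)
  qed
  finally have "qhat \<le> (1 + \<kappa>) * ((1 + 2 * \<kappa>) * (p / c))"
    using \<kappa> by (intro order_trans[OF qhat mult_left_mono]) auto
  then have "c * (1 - \<delta>) * qhat \<le> c * (1 - \<delta>) * ((1 + \<kappa>) * ((1 + 2 * \<kappa>) * (p / c)))"
    using c \<delta> by (intro mult_left_mono) auto
  also have "\<dots> = (1 - \<delta>) * ((1 + \<kappa>) * (1 + 2 * \<kappa>)) * p"
    using c by simp
  also have "\<dots> \<le> (1 - \<kappa>) ^ 3 * p"
  proof (rule mult_right_mono)
    have \<kappa>2: "\<kappa> * \<kappa> \<le> \<kappa>" "0 \<le> \<kappa> * \<kappa>" "\<kappa> * \<kappa> * \<kappa> \<le> \<kappa> * \<kappa>"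
      using \<kappa> mult_left_le[of \<kappa> \<kappa>] mult_left_le[of \<kappa> "\<kappa> * \<kappa>"] by auto
    \<comment> \<open>The product of the last two factors is
      \<open>1 + 3 * \<kappa> + 2 * (\<kappa> * \<kappa>)\<close>, at most
      \<open>1 + 5 * \<kappa>\<close>.\<close>
    have "(1 - \<delta>) * ((1 + \<kappa>) * (1 + 2 * \<kappa>)) \<le> (1 - 8 * \<kappa>) * (1 + 5 * \<kappa>)"
      using \<delta> \<kappa>2 by (intro mult_mono) (auto simp: algebra_simps)
    also have "(1 - 8 * \<kappa>) * (1 + 5 * \<kappa>) = 1 - 3 * \<kappa> - 40 * (\<kappa> * \<kappa>)"
      by (simp add: algebra_simps)
    also have "\<dots> \<le> 1 - 3 * \<kappa> + 3 * (\<kappa> * \<kappa>) - \<kappa> * \<kappa> * \<kappa>"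
      using \<kappa>2 by linarith
    also have "\<dots> = (1 - \<kappa>) ^ 3"
      by (simp add: power3_eq_cube algebra_simps)
    finally show "(1 - \<delta>) * ((1 + \<kappa>) * (1 + 2 * \<kappa>)) \<le> (1 - \<kappa>) ^ 3" .
  qed (use p in simp)
  finally show ?thesis using phat' by linarith
qed

section \<open>Choice of \<open>N\<close> and the probability estimate\<close>

theorem theorem2:
  fixes \<pi> \<rho> :: "real ^ 'k::finite \<Rightarrow> real"
    and kbar :: 'k
    and c \<epsilon> \<delta> \<eta> :: real
  assumes "CARD('k) \<ge> 2"
    and "density_on_simplex \<pi>" and "condition_P \<pi>"
    and "density_on_simplex \<rho>" and "condition_P \<rho>"
    and "0 < c"
    and "0 < \<epsilon>" and "\<epsilon> < 1"
    and "0 < \<delta>" and "\<delta> < 1"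
    and "0 < \<eta>" and "\<eta> < 1"
  shows "\<exists>N::nat. 1 \<le> N \<and>
    (\<forall>d :: nat \<Rightarrow> die. \<forall>p \<in> prob_simplex. \<forall>q \<in> prob_simplex. \<forall>n::nat.
       c * q $ kbar \<le> p $ kbar \<longrightarrow>
       1 \<le> n \<longrightarrow>
       real N \<le> real (blue_tosses d n) * p $ kbar \<longrightarrow>
       real (blue_tosses d n) / real n \<le> 1 - \<eta> \<longrightarrow>
       1 - \<epsilon> \<le> measure (toss_measure d p q)
         {\<omega> \<in> space (toss_measure d p q).
            c * (1 - \<delta>) * bayes_estimator \<rho> Red (observations d n \<omega>) kbar
              \<le> bayes_estimator \<pi> Blue (observations d n \<omega>) kbar})"
proof -
  define \<kappa> where "\<kappa> = \<delta> / 8"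
  have \<kappa>: "0 < \<kappa>" "\<kappa> < 1" using assms(9,10) by (auto simp: \<kappa>_def)
  obtain \<alpha> :: "real ^ 'k" and N1 :: nat where \<alpha>: "\<And>k. 0 < \<alpha> $ k"
    and N1: "\<And>y n k. N1 \<le> n \<Longrightarrow> (\<Sum>i\<in>UNIV. y i) = n \<Longrightarrow>
      (1 - \<kappa>) * ((\<alpha> $ k + real (y k)) / ((\<Sum>i\<in>UNIV. \<alpha> $ i) + n)) \<le> posterior_mean \<pi> y k"
    using condition_P_posterior_mean[OF assms(1-3) \<kappa>] by metis
  obtain \<beta> :: "real ^ 'k" and N2 :: nat where \<beta>: "\<And>k. 0 < \<beta> $ k"
    and N2: "\<And>y n k. N2 \<le> n \<Longrightarrow> (\<Sum>i\<in>UNIV. y i) = n \<Longrightarrow>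
      posterior_mean \<rho> y k \<le> (1 + \<kappa>) * ((\<beta> $ k + real (y k)) / ((\<Sum>i\<in>UNIV. \<beta> $ i) + n))"
    using condition_P_posterior_mean[OF assms(1,4,5) \<kappa>] by metis
  define A where "A = (\<Sum>i\<in>UNIV. \<alpha> $ i)"
  define B where "B = (\<Sum>i\<in>UNIV. \<beta> $ i)"
  have AB: "0 < A" "0 < B" unfolding A_def B_def by (auto intro!: sum_pos \<alpha> \<beta>)
  \<comment> \<open>\<open>N1\<close> and \<open>N2 / \<eta>\<close> make both posterior
    approximations valid, the next two terms make the prior weights negligible against the tosses,
    and the last two bound the blue and the red exceptional probability by
    \<open>\<epsilon> / 2\<close> each. Terms for the red die carry \<open>1 / \<eta>\<close>
    because only \<open>\<eta> * N\<close> is guaranteed there.\<close>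
  define N where "N = 1 + N1 + nat \<lceil>N2 / \<eta>\<rceil> + nat \<lceil>A / \<kappa>\<rceil> + nat \<lceil>\<beta> $ kbar * c / (\<kappa> * \<eta>)\<rceil>
     + nat \<lceil>2 / (\<kappa>\<^sup>2 * \<epsilon>)\<rceil> + nat \<lceil>2 * c / (\<kappa>\<^sup>2 * \<eta> * \<epsilon>)\<rceil>"
  have N: "1 \<le> N" "N1 \<le> N" "N2 / \<eta> \<le> N" "A / \<kappa> \<le> N" "\<beta> $ kbar * c / (\<kappa> * \<eta>) \<le> N"
    "2 / (\<kappa>\<^sup>2 * \<epsilon>) \<le> N" "2 * c / (\<kappa>\<^sup>2 * \<eta> * \<epsilon>) \<le> N"
    unfolding N_def by linarith+
  show ?thesis
  proof (intro exI[of _ N] conjI N(1) allI ballI impI)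
    fix d :: "nat \<Rightarrow> die" and p q :: "real ^ 'k" and n :: nat
    assume p: "p \<in> prob_simplex" and q: "q \<in> prob_simplex" and cq: "c * q $ kbar \<le> p $ kbar"
      and n: "1 \<le> n" and bN: "real N \<le> real (blue_tosses d n) * p $ kbar"
      and bn: "real (blue_tosses d n) / real n \<le> 1 - \<eta>"
    let ?M = "toss_measure d p q"
    interpret PM: prob_space ?M
      unfolding toss_measure_def by (intro prob_space_PiM measure_pmf.prob_space_axioms)
    define b where "b = card (tosses d n Blue)"
    define r where "r = card (tosses d n Red)"
    have bt: "blue_tosses d n = b" by (simp add: blue_tosses_def b_def tosses_def)
    define x where "x = p $ kbar"
    define z where "z = q $ kbar"
    have x: "0 \<le> x" "x \<le> 1" and z: "0 \<le> z" using p q by (auto simp: x_def z_def prob_simplex_def)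
    have bx: "real N \<le> b * x" using bN by (simp add: bt x_def)
    have "b * x \<le> b" using x by (simp add: mult_left_le)
    then have bN': "real N \<le> b" using bx by linarith
    have "0 < b * x" using bx N(1) by linarith
    then have b0: "0 < real b" and x0: "0 < x" using x by (auto simp: zero_less_mult_iff)
    have bn': "b \<le> (1 - \<eta>) * n" using bn n by (simp add: bt field_simps)
    have "(1 - \<eta>) * n \<le> n" using assms(11) by (simp add: algebra_simps)
    then have "b \<le> n" using bn' by linarith
    then have rn: "real r = real n - real b"
      by (simp add: r_def card_tosses_Red flip: b_def)
    \<comment> \<open>The share of red tosses is at least \<eta>, so \<open>r\<close> is at least
      \<open>\<eta> * n\<close>. This transfers the lower bound on \<open>b * x\<close> to
      \<open>r * x\<close>, with the blue probability \<open>x\<close> in both.\<close>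
    have rb: "\<eta> * b \<le> r"
    proof -
      have "\<eta> * b \<le> \<eta> * n" using \<open>b \<le> n\<close> assms(11) by simp
      then show ?thesis using bn' by (simp add: rn algebra_simps)
    qed
    have rx: "\<eta> * N \<le> r * x"
    proof -
      have "\<eta> * N \<le> \<eta> * (b * x)" using bx assms(11) by simp
      also have "\<dots> \<le> r * x" using mult_right_mono[OF rb x(1)] by (simp add: mult.assoc)
      finally show ?thesis .
    qed
    have rN: "\<eta> * N \<le> r"
      using rx x mult_left_le[of x "real r"] by linarith
    have "0 < \<eta> * N" using assms(11) N(1) by simp
    then have r0: "0 < real r" using rN by linarith
    \<comment> \<open>The exceptional events: an atypical blue count, and a red count that deviates
      on the scale of \<open>x / c\<close> rather than of its own probability
      \<open>z\<close>.\<close>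
    define U where "U = {\<omega>\<in>space ?M. \<kappa> * (b * x) \<le> \<bar>real (count_list (observations d n \<omega>) (Blue, kbar)) - b * x\<bar>}"
    define V where "V = {\<omega>\<in>space ?M. \<kappa> * (r * x / c) \<le> \<bar>real (count_list (observations d n \<omega>) (Red, kbar)) - r * z\<bar>}"
    have UV: "U \<in> sets ?M" "V \<in> sets ?M"
      unfolding U_def V_def by (rule sets_observations)+
    have PU: "measure ?M U \<le> \<epsilon> / 2"
    proof -
      have "measure ?M U \<le> b * x / (\<kappa> * (b * x))\<^sup>2"
        using toss_Chebyshev[where c = Blue and p = p and q = q and e = "\<kappa> * (b * x)" and d = d and n = n and k = kbar] p \<kappa> b0 x0
        by (simp add: U_def b_def x_def)
      also have "\<dots> = 1 / (\<kappa>\<^sup>2 * (b * x))"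
        using \<kappa> b0 x0 by (simp add: power2_eq_square)
      also have "\<dots> \<le> \<epsilon> / 2"
      proof -
        have "2 / (\<kappa>\<^sup>2 * \<epsilon>) \<le> b * x" using N(6) bx by linarith
        then show ?thesis using \<kappa> assms(7) b0 x0 by (simp add: field_simps)
      qed
      finally show ?thesis .
    qed
    have PV: "measure ?M V \<le> \<epsilon> / 2"
    proof -
      have "measure ?M V \<le> r * z / (\<kappa> * (r * x / c))\<^sup>2"
        using toss_Chebyshev[where c = Red and p = p and q = q and e = "\<kappa> * (r * x / c)" and d = d and n = n and k = kbar] q \<kappa> r0 x0 assms(6)
        by (simp add: V_def r_def z_def)
      \<comment> \<open>The variance bound involves \<open>z\<close>, which the hypothesis limits to
        \<open>x / c\<close>; no lower bound on \<open>z\<close> enters.\<close>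
      also have "\<dots> \<le> (r * x / c) / (\<kappa> * (r * x / c))\<^sup>2"
      proof (rule divide_right_mono)
        have "z \<le> x / c" using cq assms(6) by (simp add: x_def z_def field_simps)
        then show "r * z \<le> r * x / c" using mult_left_mono[of z "x / c" "real r"] by simp
      qed simp
      also have "\<dots> = c / (\<kappa>\<^sup>2 * (r * x))"
        using \<kappa> r0 x0 assms(6) by (simp add: power2_eq_square)
      also have "\<dots> \<le> \<epsilon> / 2"
      proof -
        have "2 * c / (\<kappa>\<^sup>2 * \<epsilon>) = \<eta> * (2 * c / (\<kappa>\<^sup>2 * \<eta> * \<epsilon>))" using assms(11) by simp
        also have "\<dots> \<le> \<eta> * N" using N(7) assms(11) by (intro mult_left_mono) auto
        finally have "2 * c / (\<kappa>\<^sup>2 * \<epsilon>) \<le> r * x" using rx by linarith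
        then show ?thesis using \<kappa> assms(7) r0 x0 by (simp add: field_simps)
      qed
      finally show ?thesis .
    qed
    let ?S = "{\<omega> \<in> space ?M. c * (1 - \<delta>) * bayes_estimator \<rho> Red (observations d n \<omega>) kbar
              \<le> bayes_estimator \<pi> Blue (observations d n \<omega>) kbar}"
    have S: "?S \<in> sets ?M" by (rule sets_observations)
    \<comment> \<open>Off the exceptional events the comparison holds for every outcome.\<close>
    have "space ?M - (U \<union> V) \<subseteq> ?S"
    proof safe
      fix \<omega> assume \<omega>: "\<omega> \<in> space ?M" "\<omega> \<notin> U" "\<omega> \<notin> V"
      let ?y = "\<lambda>i. count_list (observations d n \<omega>) (Blue, i)"
      let ?z = "\<lambda>i. count_list (observations d n \<omega>) (Red, i)"
      show "c * (1 - \<delta>) * bayes_estimator \<rho> Red (observations d n \<omega>) kbar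
              \<le> bayes_estimator \<pi> Blue (observations d n \<omega>) kbar"
        unfolding bayes_estimator_eq_posterior_mean
      proof (rule blue_red_comparison[where \<kappa> = \<kappa> and b = "real b" and A = A and \<alpha>k = "\<alpha> $ kbar"
            and r = "real r" and B = B and \<beta>k = "\<beta> $ kbar" and p = x and q = z
            and Y = "real (?y kbar)" and Z = "real (?z kbar)"])
        show "A \<le> \<kappa> * real b"
        proof -
          have "A / \<kappa> \<le> b" using N(4) bN' by linarith
          then show ?thesis using \<kappa> by (simp add: field_simps)
        qed
        show "\<beta> $ kbar * c \<le> \<kappa> * (real r * x)"
        proof -
          have "\<beta> $ kbar * c / \<kappa> = \<eta> * (\<beta> $ kbar * c / (\<kappa> * \<eta>))" using assms(11) by simp
          also have "\<dots> \<le> \<eta> * N" using N(5) assms(11) by (intro mult_left_mono) auto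
          finally have "\<beta> $ kbar * c / \<kappa> \<le> r * x" using rx by linarith
          then show ?thesis using \<kappa> by (simp add: field_simps)
        qed
        show "(1 - \<kappa>) * ((\<alpha> $ kbar + real (?y kbar)) / (A + real b)) \<le> posterior_mean \<pi> ?y kbar"
          unfolding A_def using N(2) bN'
          by (intro N1) (auto simp: b_def sum_count_observations)
        have "N2 \<le> \<eta> * N" using N(3) assms(11) by (simp add: field_simps)
        then have "N2 \<le> r" using rN by linarith
        then show "posterior_mean \<rho> ?z kbar \<le> (1 + \<kappa>) * ((\<beta> $ kbar + real (?z kbar)) / (B + real r))"
          unfolding B_def by (intro N2) (auto simp: r_def sum_count_observations)
        show "0 \<le> \<beta> $ kbar + real (?z kbar)" using \<beta>[of kbar] by simp
      qed (use assms AB \<alpha> b0 r0 x0 cq \<omega> in \<open>auto simp: \<kappa>_def x_def z_def U_def V_def not_le\<close>)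
    qed
    then have "measure ?M (space ?M - (U \<union> V)) \<le> measure ?M ?S"
      using S by (rule PM.finite_measure_mono)
    moreover have "measure ?M (space ?M - (U \<union> V)) = 1 - measure ?M (U \<union> V)"
      using UV by (intro PM.prob_compl) auto
    moreover have "measure ?M (U \<union> V) \<le> measure ?M U + measure ?M V"
      using UV by (intro measure_Un_le)
    ultimately show "1 - \<epsilon> \<le> measure ?M ?S"
      using PU PV by linarith
  qed
qed

end
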